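(* For every $\lambda\in X_+$ one has, in $\mathbb{Z}[X_+]$, $$[\mathcal{B}(\lambda)]_{v=1}=(\underline{\mathbf{H}}_\lambda)_{v=1}\qquad\text{and}\qquad[\mathcal{P}(\lambda)]_{v=1}=(\tilde{\mathbf{N}}^3_\lambda)_{v=1}.$$
   Context: **Root data (type $C_2$).** $X=\mathbb{Z}\varpi_1\oplus\mathbb{Z}\varpi_2$ is the weight lattice of $Sp_4(\mathbb{C})$, $\mu=(\mu_1,\mu_2)=\mu_1\varpi_1+\mu_2\varpi_2$, $X_+=\{\mu:\mu_1,\mu_2\ge 0\}$; positive roots $\alpha_1=2\varpi_1-\varpi_2$, $\alpha_2=-2\varpi_1+2\varpi_2$, $\alpha_{12}=2\varpi_1$, $\alpha_{21}=\varpi_2$; $\rho=\varpi_1+\varpi_2$; $W$ the Weyl group, dot action $w\cdot\lambda=w(\lambda+\rho)-\rho$. **Spherical Hecke algebra.** $\mathcal{H}$ is the spherical Hecke algebra, free over $\mathbb{Z}[v,v^{-1}]$ with standard basis $\{\mathbf{H}_\lambda\}_{\lambda\in X_+}$ and Kazhdan–Lusztig basis $\{\underline{\mathbf{H}}_\lambda\}_{\lambda\in X_+}$, $\underline{\mathbf{H}}_\lambda=\sum_{\mu\in X_+,\mu\le\lambda}K_{\lambda,\mu}(v^2)\mathbf{H}_\mu$, where $K_{\lambda,\mu}(q)=\sum_{w\in W}(-1)^{\ell(w)}P_q(w(\lambda+\rho)-(\mu+\rho))$ is the Kostka–Foulkes polynomial, $\sum_\nu P_q(\nu)e^\nu=\prod_{\beta\in\Phi_+}(1-qe^\beta)^{-1}$.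 Specialization $(-)_{v=1}:\mathcal{H}\to\mathbb{Z}[X_+]$ sends $\mathbf{H}_\lambda\mapsto e^\lambda$. For $\lambda\in X$ not dominant, $\underline{\mathbf{H}}_\lambda=0$ if $\lambda+\rho$ has nontrivial stabilizer in $W$, and $\underline{\mathbf{H}}_\lambda=(-1)^{\ell(w)}\underline{\mathbf{H}}_{w\cdot\lambda}$ if $w\cdot\lambda\in X_+$. For $\lambda\in X_+$: $\tilde{\mathbf{N}}^3_\lambda=\underline{\mathbf{H}}_\lambda-v^2\underline{\mathbf{H}}_{\lambda-2\varpi_1}$ if $\lambda_1\ne0$, and $\tilde{\mathbf{N}}^3_\lambda=\underline{\mathbf{H}}_\lambda$ if $\lambda_1=0$. **Crystals.** $\mathcal{B}(\lambda)$ is the (normal) crystal of the irreducible $\mathfrak{sp}_4$-module of highest weight $\lambda$, with operators $e_i,f_i$ ($i=1,2$). For $T\in\mathcal{B}(\lambda)$, $\mathrm{str}_2(T)=(a,b,c,d)$ is the adapted string for $s_2s_1s_2s_1$: $a=\varepsilon_2(T)$, $b=\varepsilon_1(e_2^aT)$, $c=\varepsilon_2(e_1^be_2^aT)$, $d=\varepsilon_1(e_2^ce_1^be_2^aT)$. There is an injective weight-preserving crystal embedding $\Phi:\mathcal{B}(\lambda)\to\mathcal{B}(\lambda+2\varpi_1)$ with $\mathrm{str}_2(\Phi(T))=\mathrm{str}_2(T)+(0,1,1,1)$. Principal preatom: $\mathcal{P}(\lambda)=\mathcal{B}(\lambda)\setminus\Phi(\mathcal{B}(\lambda-2\varpi_1))$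 if $\lambda_1\ge2$, and $\mathcal{P}(\lambda)=\mathcal{B}(\lambda)$ if $\lambda_1\le 1$. **Ungraded character.** For a $W$-stable subset $C\subset\mathcal{B}(\lambda)$ ($W$ acting on the crystal with $s_i$ reversing $f_i$-strings), $[C]_{v=1}=\sum e^{\mathrm{wt}(T)}\in\mathbb{Z}[X_+]$, the sum over $T\in C$ with dominant weight. *)

theory Defs
  imports
    "HOL-Computational_Algebra.Polynomial"
    "HOL-Library.Poly_Mapping"
    "HOL-Library.Product_Plus"
begin

section \<open>Root data of type C2\<close>

text \<open>The pair \<open>(a, b)\<close> stands for \<open>a \<varpi>\<^sub>1 + b \<varpi>\<^sub>2\<close>. The simple root \<open>\<alpha>\<^sub>1\<close> is the
  short one and \<open>\<alpha>\<^sub>2\<close> the long one.\<close>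

type_synonym weight = "int \<times> int"

datatype node = Node1 | Node2

definition wscale :: "int \<Rightarrow> weight \<Rightarrow> weight" where
  "wscale k mu = (k * fst mu, k * snd mu)"

definition varpi1 :: weight where "varpi1 = (1, 0)"
definition varpi2 :: weight where "varpi2 = (0, 1)"

definition rho :: weight where "rho = varpi1 + varpi2"

definition X_plus :: "weight set" where
  "X_plus = {mu. 0 \<le> fst mu \<and> 0 \<le> snd mu}"

fun simple_root :: "node \<Rightarrow> weight" where
  "simple_root Node1 = (2, -1)"
| "simple_root Node2 = (-2, 2)"

definition positive_roots :: "weight set" where
  "positive_roots = {(2, -1), (-2, 2), (2, 0), (0, 1)}"

text \<open>\<open>coroot_pairing i mu\<close> is \<open>\<langle>mu, \<alpha>\<^sub>i\<^sup>\<or>\<rangle>\<close>, that is, the coefficient of \<open>\<varpi>\<^sub>i\<close> in \<open>mu\<close>.\<close>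

fun coroot_pairing :: "node \<Rightarrow> weight \<Rightarrow> int" where
  "coroot_pairing Node1 mu = fst mu"
| "coroot_pairing Node2 mu = snd mu"

definition simple_reflection :: "node \<Rightarrow> weight \<Rightarrow> weight" where
  "simple_reflection i mu = mu - wscale (coroot_pairing i mu) (simple_root i)"

inductive_set weyl_group :: "(weight \<Rightarrow> weight) set" where
  weyl_id: "id \<in> weyl_group"
| weyl_step: "w \<in> weyl_group \<Longrightarrow> simple_reflection i \<circ> w \<in> weyl_group"

definition weyl_length :: "(weight \<Rightarrow> weight) \<Rightarrow> nat" where
  "weyl_length w = (LEAST n. \<exists>is. length is = n \<and> w = foldr (\<lambda>i u. simple_reflection i \<circ> u) is id)"

definition dot_action :: "(weight \<Rightarrow> weight) \<Rightarrow> weight \<Rightarrow> weight" where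
  "dot_action w mu = w (mu + rho) - rho"

definition dominance_le :: "weight \<Rightarrow> weight \<Rightarrow> bool" where
  "dominance_le mu la \<longleftrightarrow> (\<exists>a b :: nat.
     la - mu = wscale (int a) (simple_root Node1) + wscale (int b) (simple_root Node2))"


section \<open>Kostka--Foulkes polynomials\<close>

text \<open>Expanding every factor of \<open>\<Prod>\<beta>\<in>\<Phi>\<^sub>+. (1 - q e\<^sup>\<beta>)\<^sup>-\<^sup>1\<close> as a geometric series, the
  coefficient of \<open>e\<^sup>\<nu>\<close> is the sum of \<open>q\<close> to the power \<open>\<Sum>\<beta>. m \<beta>\<close> over all the
  multiplicity functions \<open>m\<close> on \<open>\<Phi>\<^sub>+\<close> with \<open>\<Sum>\<beta>. m \<beta> \<beta> = \<nu>\<close>.\<close>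

definition kostant_partitions :: "weight \<Rightarrow> (weight \<Rightarrow> nat) set" where
  "kostant_partitions nu = {m. (\<forall>b. b \<notin> positive_roots \<longrightarrow> m b = 0) \<and>
     (\<Sum>b\<in>positive_roots. wscale (int (m b)) b) = nu}"

definition q_kostant :: "weight \<Rightarrow> int poly" where
  "q_kostant nu = (\<Sum>m\<in>kostant_partitions nu. monom 1 (\<Sum>b\<in>positive_roots. m b))"

definition kostka_foulkes :: "weight \<Rightarrow> weight \<Rightarrow> int poly" where
  "kostka_foulkes la mu =
     (\<Sum>w\<in>weyl_group. (-1) ^ weyl_length w * q_kostant (w (la + rho) - (mu + rho)))"


section \<open>The spherical Hecke algebra\<close>

text \<open>\<open>\<int>[v, v\<^sup>-\<^sup>1]\<close> is the group ring of \<open>\<int>\<close> over \<open>\<int>\<close>. The spherical Hecke algebra is the free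
  module over it with basis \<open>X_plus\<close>; only this module structure is needed. In both
  \<open>hecke\<close> and \<open>\<int>[X_plus]\<close> the index type is all of \<open>weight\<close>, and the elements below have
  support in \<open>X_plus\<close>. The multiplication that \<open>Poly_Mapping\<close> puts on \<open>hecke\<close> is not the one
  of the Hecke algebra, and it is not used.\<close>

type_synonym laurent = "int \<Rightarrow>\<^sub>0 int"
type_synonym hecke = "weight \<Rightarrow>\<^sub>0 laurent"

definition v :: laurent where "v = Poly_Mapping.single 1 1"

definition hscale :: "laurent \<Rightarrow> hecke \<Rightarrow> hecke" where
  "hscale c h = Poly_Mapping.map (\<lambda>x. c * x) h"

definition H_std :: "weight \<Rightarrow> hecke" where
  "H_std mu = Poly_Mapping.single mu 1"

definition poly_at_v2 :: "int poly \<Rightarrow> laurent" where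
  "poly_at_v2 p = poly (map_poly of_int p) (v ^ 2)"

definition H_KL_dominant :: "weight \<Rightarrow> hecke" where
  "H_KL_dominant la = (\<Sum>mu\<in>{mu \<in> X_plus. dominance_le mu la}.
     hscale (poly_at_v2 (kostka_foulkes la mu)) (H_std mu))"

text \<open>If \<open>la + rho\<close> has trivial stabilizer, there is exactly one \<open>w\<close> with \<open>w \<cdot> la\<close> dominant.\<close>

definition H_KL :: "weight \<Rightarrow> hecke" where
  "H_KL la =
     (if la \<in> X_plus then H_KL_dominant la
      else if \<exists>w\<in>weyl_group. w \<noteq> id \<and> w (la + rho) = la + rho then 0
      else let w = (THE w. w \<in> weyl_group \<and> dot_action w la \<in> X_plus)
           in hscale ((-1) ^ weyl_length w) (H_KL_dominant (dot_action w la)))"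

definition N3_tilde :: "weight \<Rightarrow> hecke" where
  "N3_tilde la =
     (if fst la \<noteq> 0 then H_KL la - hscale (v ^ 2) (H_KL (la - wscale 2 varpi1)) else H_KL la)"

definition laurent_at_1 :: "laurent \<Rightarrow> int" where
  "laurent_at_1 p = (\<Sum>k\<in>Poly_Mapping.keys p. Poly_Mapping.lookup p k)"

definition specialize_v1 :: "hecke \<Rightarrow> (weight \<Rightarrow>\<^sub>0 int)" where
  "specialize_v1 h = (\<Sum>mu\<in>Poly_Mapping.keys h.
     Poly_Mapping.single mu (laurent_at_1 (Poly_Mapping.lookup h mu)))"


section \<open>Crystals\<close>

text \<open>The crystal of the vector representation, \<open>1 \<rightarrow> 2 \<rightarrow> 2' \<rightarrow> 1'\<close> with arrows labelled
  1, 2, 1, where primes stand for bars.\<close>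

datatype letter = L1 | L2 | L2bar | L1bar

fun letter_wt :: "letter \<Rightarrow> weight" where
  "letter_wt L1 = (1, 0)"
| "letter_wt L2 = (-1, 1)"
| "letter_wt L2bar = (1, -1)"
| "letter_wt L1bar = (-1, 0)"

fun letter_f :: "node \<Rightarrow> letter \<Rightarrow> letter option" where
  "letter_f Node1 L1 = Some L2"
| "letter_f Node1 L2bar = Some L1bar"
| "letter_f Node2 L2 = Some L2bar"
| "letter_f _ _ = None"

fun letter_e :: "node \<Rightarrow> letter \<Rightarrow> letter option" where
  "letter_e Node1 L2 = Some L1"
| "letter_e Node1 L1bar = Some L2bar"
| "letter_e Node2 L2bar = Some L2"
| "letter_e _ _ = None"

definition letter_eps :: "node \<Rightarrow> letter \<Rightarrow> nat" where
  "letter_eps i x = (if letter_e i x = None then 0 else 1)"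

definition letter_phi :: "node \<Rightarrow> letter \<Rightarrow> nat" where
  "letter_phi i x = (if letter_f i x = None then 0 else 1)"

text \<open>The word \<open>[x\<^sub>1, \<dots>, x\<^sub>n]\<close> stands for \<open>x\<^sub>1 \<otimes> \<dots> \<otimes> x\<^sub>n\<close> in the tensor power of the vector
  crystal, with the tensor product rule in Kashiwara's convention: \<open>f\<^sub>i\<close> acts on the left factor
  of \<open>x \<otimes> y\<close> iff \<open>\<phi>\<^sub>i x > \<epsilon>\<^sub>i y\<close>, \<open>e\<^sub>i\<close> acts on it iff \<open>\<phi>\<^sub>i x \<ge> \<epsilon>\<^sub>i y\<close>, and
  \<open>\<epsilon>\<^sub>i (x \<otimes> y) = \<epsilon>\<^sub>i x + max 0 (\<epsilon>\<^sub>i y - \<phi>\<^sub>i x)\<close>; below this maximum is the truncated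
  subtraction of natural numbers. \<open>None\<close> plays the role of the element 0.\<close>

definition word_wt :: "letter list \<Rightarrow> weight" where
  "word_wt xs = (\<Sum>x\<leftarrow>xs. letter_wt x)"

fun word_eps :: "node \<Rightarrow> letter list \<Rightarrow> nat" where
  "word_eps i [] = 0"
| "word_eps i (x # xs) = letter_eps i x + (word_eps i xs - letter_phi i x)"

fun word_e :: "node \<Rightarrow> letter list \<Rightarrow> letter list option" where
  "word_e i [] = None"
| "word_e i (x # xs) =
     (if letter_phi i x \<ge> word_eps i xs then map_option (\<lambda>y. y # xs) (letter_e i x)
      else map_option (\<lambda>ys. x # ys) (word_e i xs))"

fun word_f :: "node \<Rightarrow> letter list \<Rightarrow> letter list option" where
  "word_f i [] = None"
| "word_f i (x # xs) =
     (if letter_phi i x > word_eps i xs then map_option (\<lambda>y. y # xs) (letter_f i x)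
      else map_option (\<lambda>ys. x # ys) (word_f i xs))"

fun word_e_power :: "node \<Rightarrow> nat \<Rightarrow> letter list \<Rightarrow> letter list option" where
  "word_e_power i 0 xs = Some xs"
| "word_e_power i (Suc n) xs = Option.bind (word_e i xs) (word_e_power i n)"

text \<open>The two facts below show that \<open>word_eps i xs\<close> is the largest \<open>n\<close> with \<open>e\<^sub>i\<^sup>n xs \<noteq> 0\<close>,
  as it has to be in a normal crystal, and that \<open>e\<^sub>i\<close> and \<open>f\<^sub>i\<close> are partial inverses.\<close>

lemma letter_e_eq_Some_iff: "letter_e i x = Some y \<longleftrightarrow> letter_f i y = Some x"
  by (cases i; cases x; cases y) auto

lemma word_e_eq_None_iff: "word_e i xs = None \<longleftrightarrow> word_eps i xs = 0"
  by (induction xs) (auto simp: letter_eps_def)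

lemma letter_e_eps_phi:
  "letter_e i x = Some y \<Longrightarrow>
     letter_eps i x = 1 \<and> letter_phi i x = 0 \<and> letter_eps i y = 0 \<and> letter_phi i y = 1"
  by (cases i; cases x; cases y) (auto simp: letter_eps_def letter_phi_def)

lemma word_eps_word_e: "word_e i xs = Some ys \<Longrightarrow> word_eps i xs = Suc (word_eps i ys)"
proof (induction xs arbitrary: ys)
  case (Cons x xs)
  then show ?case
    by (auto split: if_splits dest!: letter_e_eps_phi)
qed simp

lemma word_eps_max: "word_e_power i n xs \<noteq> None \<longleftrightarrow> n \<le> word_eps i xs"
proof (induction n arbitrary: xs)
  case (Suc n)
  show ?case
  proof (cases "word_e i xs")
    case None
    then show ?thesis using word_e_eq_None_iff[of i xs] by simp
  next
    case (Some ys)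
    then show ?thesis using Suc[of ys] word_eps_word_e[OF Some] by simp
  qed
qed simp

lemma word_e_eq_Some_iff: "word_e i xs = Some ys \<longleftrightarrow> word_f i ys = Some xs"
proof (induction xs arbitrary: ys)
  case Nil
  then show ?case
    by (cases ys) auto
next
  case (Cons x xs)
  show ?case
  proof (cases ys)
    case Nil
    then show ?thesis by auto
  next
    case ys: (Cons y zs)
    show ?thesis
      using Cons[of zs] letter_e_eq_Some_iff[of i x y] letter_e_eps_phi[of i x y]
        word_eps_word_e[of i xs zs]
      by (auto simp: ys)
  qed
qed

text \<open>For dominant \<open>la\<close>, \<open>crystal la\<close> is the connected component of the highest weight element
  \<open>1\<^sup>\<otimes>\<^sup>a \<otimes> (1 \<otimes> 2)\<^sup>\<otimes>\<^sup>b\<close>, \<open>la = a \<varpi>\<^sub>1 + b \<varpi>\<^sub>2\<close>, in the tensor power of the vector crystal, hence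
  it is the crystal of the irreducible module of highest weight \<open>la\<close>; its elements are the
  readings of the Kashiwara--Nakashima tableaux of shape \<open>la\<close> by columns from right to left.\<close>

definition highest_word :: "weight \<Rightarrow> letter list" where
  "highest_word la =
     replicate (nat (fst la)) L1 @ concat (replicate (nat (snd la)) [L1, L2])"

inductive_set crystal :: "weight \<Rightarrow> letter list set" for la :: weight where
  crystal_highest: "highest_word la \<in> crystal la"
| crystal_f: "xs \<in> crystal la \<Longrightarrow> word_f i xs = Some ys \<Longrightarrow> ys \<in> crystal la"
| crystal_e: "xs \<in> crystal la \<Longrightarrow> word_e i xs = Some ys \<Longrightarrow> ys \<in> crystal la"

definition word_e_max :: "node \<Rightarrow> letter list \<Rightarrow> letter list" where
  "word_e_max i xs = the (word_e_power i (word_eps i xs) xs)"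

definition str2 :: "letter list \<Rightarrow> nat \<times> nat \<times> nat \<times> nat" where
  "str2 T =
     (let T1 = word_e_max Node2 T; T2 = word_e_max Node1 T1; T3 = word_e_max Node2 T2
      in (word_eps Node2 T, word_eps Node1 T1, word_eps Node2 T2, word_eps Node1 T3))"

text \<open>An element of \<open>crystal la\<close> is determined by its string, so the condition on strings
  determines the embedding of \<open>crystal la\<close> into \<open>crystal (la + 2 \<varpi>\<^sub>1)\<close>.\<close>

definition Phi :: "weight \<Rightarrow> letter list \<Rightarrow> letter list" where
  "Phi la T = (THE T'. T' \<in> crystal (la + wscale 2 varpi1) \<and> str2 T' = str2 T + (0, 1, 1, 1))"

definition preatom :: "weight \<Rightarrow> letter list set" where
  "preatom la =
     (if 2 \<le> fst la
      then crystal la - Phi (la - wscale 2 varpi1) ` crystal (la - wscale 2 varpi1)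
      else crystal la)"

definition ungraded_character :: "letter list set \<Rightarrow> (weight \<Rightarrow>\<^sub>0 int)" where
  "ungraded_character C =
     (\<Sum>T\<in>{T \<in> C. word_wt T \<in> X_plus}. Poly_Mapping.single (word_wt T) 1)"

end

(* The crystal is described explicitly by the column multiplicities of Kashiwara-Nakashima
   tableaux. On these the operators e_i, the maximal strings and hence str2 have closed formulas,
   which show that T is determined by its string, that the highest weight element is unique, and
   that str2 T + (0,1,1,1) is again a string two steps further along varpi_1.

   Let F be an alternating function on weights, F (s_i x) = - F x. The Gessel-Zeilberger involution
   cancels all words that are not of highest weight in the sum of F (wt T + rho) over the crystal,
   so that this sum is F (la + rho). For F x = sum over w of (-1)^l(w) P (w x - (mu + rho)), with P
   Kostant's partition function, the right-hand side is the Kostka-Foulkes polynomial at q = 1, and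
   by the Weyl invariance of the weights and the denominator formula the left-hand side is the
   number of elements of weight mu. *)
theory Submission
  imports Defs
begin

section \<open>Tensor products of words\<close>

text \<open>At v = 1 the first identity is Kostant's multiplicity formula for the crystal. The
  second follows from it once \<open>Phi\<close> is a weight-preserving injection, since the factor
  v^2 becomes 1. The word s2 s1 s2 s1 is a reduced word of the longest element of W; this is why
  four maximal strings in that order raise every element to the highest weight. Here it is read off
  from the closed formulas. The shift (0,1,1,1) stands for two more steps e_1 and one more step e_2.
  As 2 \<alpha>1 + \<alpha>2 = 2 \<varpi>1, it is compensated exactly by the larger highest weight.
  The danger in the cancellation is that reflecting a suffix of a word may leave the crystal. The
  cut is chosen so that the prefix has phi = 0 for the node i concerned; the suffix then moves
  inside one i-string of the whole word.\<close>

fun word_phi :: "node \<Rightarrow> letter list \<Rightarrow> nat" where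
  "word_phi i [] = 0"
| "word_phi i (x # xs) = word_phi i xs + (letter_phi i x - word_eps i xs)"

lemma word_eps_append:
  "word_eps i (xs @ ys) = word_eps i xs + (word_eps i ys - word_phi i xs)"
  by (induction xs) auto

lemma word_phi_append:
  "word_phi i (xs @ ys) = word_phi i ys + (word_phi i xs - word_eps i ys)"
  by (induction xs) (auto simp: word_eps_append)

text \<open>Associativity of the tensor product: the rule, defined by splitting off one letter,
  holds for every cut of a word.\<close>

lemma word_e_append:
  "word_e i (xs @ ys) =
     (if word_phi i xs \<ge> word_eps i ys then map_option (\<lambda>zs. zs @ ys) (word_e i xs)
      else map_option (\<lambda>zs. xs @ zs) (word_e i ys))"
proof (induction xs)
  case Nil
  then show ?case
    using word_e_eq_None_iff[of i ys] by (auto simp: option.map_id0 id_def[symmetric])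
next
  case (Cons x xs)
  have "letter_phi i x \<ge> word_eps i (xs @ ys) \<longleftrightarrow>
      letter_phi i x \<ge> word_eps i xs \<and> word_phi i (x # xs) \<ge> word_eps i ys"
    if "letter_phi i x \<ge> word_eps i xs"
    using that by (auto simp: word_eps_append)
  moreover have "letter_e i x = None" if "letter_phi i x > 0"
    using that by (cases i; cases x) (auto simp: letter_phi_def)
  ultimately show ?case
    using Cons by (auto simp: word_eps_append option.map_comp o_def)
qed

lemma letter_pairing:
  "coroot_pairing i (letter_wt x) = int (letter_phi i x) - int (letter_eps i x)"
  by (cases i; cases x) (auto simp: letter_eps_def letter_phi_def)

lemma coroot_pairing_add [simp]:
  "coroot_pairing i (mu + nu) = coroot_pairing i mu + coroot_pairing i nu"
  by (cases i) auto

lemma word_wt_simps [simp]: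
  "word_wt [] = 0" "word_wt (x # xs) = letter_wt x + word_wt xs"
  "word_wt (xs @ ys) = word_wt xs + word_wt ys"
  by (simp_all add: word_wt_def)

lemma word_pairing:
  "coroot_pairing i (word_wt xs) = int (word_phi i xs) - int (word_eps i xs)"
proof (induction xs)
  case Nil
  then show ?case by (cases i) auto
next
  case (Cons x xs)
  then show ?case by (auto simp: letter_pairing)
qed

lemma word_f_eq_None_iff: "word_f i xs = None \<longleftrightarrow> word_phi i xs = 0"
  by (induction xs) (auto simp: letter_phi_def)

lemma word_wt_word_e: "word_e i xs = Some ys \<Longrightarrow> word_wt ys = word_wt xs + simple_root i"
proof (induction xs arbitrary: ys)
  case (Cons x xs)
  have "letter_wt z = letter_wt x + simple_root i" if "letter_e i x = Some z" for z
    using that by (cases i; cases x) auto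
  with Cons show ?case by (auto split: if_splits simp: add_ac)
qed simp

lemma word_phi_word_e:
  assumes "word_e i xs = Some ys"
  shows "word_phi i ys = Suc (word_phi i xs)"
proof -
  have "coroot_pairing i (simple_root i) = 2" by (cases i) auto
  then show ?thesis
    using word_pairing[of i xs] word_pairing[of i ys] word_eps_word_e[OF assms]
      word_wt_word_e[OF assms] by simp
qed

lemma word_e_max_Some: "word_e i xs = Some ys \<Longrightarrow> word_e_max i xs = word_e_max i ys"
  by (simp add: word_e_max_def word_eps_word_e)

lemma word_e_max_None: "word_e i xs = None \<Longrightarrow> word_e_max i xs = xs"
  by (simp add: word_e_max_def word_e_eq_None_iff)

lemma word_e_max_induct [case_names None Some]:
  assumes "\<And>xs. word_e i xs = None \<Longrightarrow> P xs"
    and "\<And>xs ys. word_e i xs = Some ys \<Longrightarrow> P ys \<Longrightarrow> P xs"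
  shows "P xs"
proof (induction "word_eps i xs" arbitrary: xs)
  case 0
  then show ?case using assms(1) word_e_eq_None_iff by metis
next
  case (Suc n)
  then obtain ys where "word_e i xs = Some ys"
    using word_e_eq_None_iff[of i xs] by force
  with Suc show ?case using assms(2) word_eps_word_e by fastforce
qed

lemma word_wt_word_e_max:
  "word_wt (word_e_max i xs) = word_wt xs + wscale (int (word_eps i xs)) (simple_root i)"
proof (induction xs rule: word_e_max_induct[of i])
  case (None xs)
  then show ?case
    using word_e_eq_None_iff[of i xs] by (simp add: word_e_max_None wscale_def zero_prod_def[symmetric])
next
  case (Some xs ys)
  then show ?case
    by (simp add: word_e_max_Some word_wt_word_e word_eps_word_e wscale_def plus_prod_def algebra_simps)
qed

text \<open>An i-string is a chain, so its head and the distance \<open>word_eps\<close> from the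
  head fix the element.\<close>

lemma word_e_max_inject:
  assumes "word_eps i xs = word_eps i ys" "word_e_max i xs = word_e_max i ys"
  shows "xs = ys"
  using assms
proof (induction xs arbitrary: ys rule: word_e_max_induct[of i])
  case (None xs)
  then show ?case by (metis word_e_eq_None_iff word_e_max_None)
next
  case (Some xs zs)
  from Some have "word_e i ys \<noteq> None"
    using word_e_eq_None_iff[of i ys] word_eps_word_e[of i xs zs] by auto
  then obtain us where us: "word_e i ys = Some us" by auto
  have "zs = us" using Some us by (intro Some.IH) (auto simp: word_eps_word_e word_e_max_Some)
  then show ?case using Some us by (metis word_e_eq_Some_iff option.inject)
qed

lemma crystal_word_e_max: "word_e_max i xs \<in> crystal la \<longleftrightarrow> xs \<in> crystal la"
proof (induction xs rule: word_e_max_induct[of i])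
  case (None xs)
  then show ?case by (simp add: word_e_max_None)
next
  case (Some xs ys)
  then show ?case
    by (metis crystal_e crystal_f word_e_eq_Some_iff word_e_max_Some)
qed

section \<open>Readings of Kashiwara--Nakashima tableaux\<close>

definition word_power :: "nat \<Rightarrow> 'a list \<Rightarrow> 'a list" where
  "word_power n u = concat (replicate n u)"

lemma word_power_simps [simp]:
  "word_power 0 u = []" "word_power (Suc n) u = u @ word_power n u"
  by (simp_all add: word_power_def)

lemma word_power_commute: "u @ word_power n u = word_power n u @ u"
  by (induction n) auto

lemma word_eps_phi_power:
  "word_eps i u = 0 \<Longrightarrow> word_eps i (word_power n u) = 0"
  "word_eps i u = 0 \<Longrightarrow> word_phi i (word_power n u) = n * word_phi i u"
  "word_phi i u = 0 \<Longrightarrow> word_eps i (word_power n u) = n * word_eps i u"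
  "word_phi i u = 0 \<Longrightarrow> word_phi i (word_power n u) = 0"
  by (induction n) (auto simp: word_eps_append word_phi_append)

text \<open>Without phi in \<open>u\<close> nothing is cancelled inside the power, and the tensor
  rule sends e_i to the rightmost copy. In \<open>kn_word\<close> that copy borders the next block,
  which the raised column or letter then joins.\<close>

lemma word_e_power_word:
  assumes "word_phi i u = 0"
  shows "word_e i (word_power (Suc n) u) = map_option (\<lambda>z. word_power n u @ z) (word_e i u)"
proof -
  have eq: "word_power (Suc n) u = word_power n u @ u" by (simp add: word_power_commute)
  show ?thesis
  proof (cases "word_eps i u")
    case 0
    then have "word_e i u = None" "word_e i (word_power (Suc n) u) = None"
      by (simp_all only: word_e_eq_None_iff word_eps_phi_power(1))
    then show ?thesis by simp
  next
    case (Suc k)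
    then show ?thesis
      using word_eps_phi_power(4)[OF assms, of n] by (simp only: eq word_e_append) simp
  qed
qed

text \<open>A one-row letter is counted by \<open>n1b\<close>, \<open>n2b\<close>, \<open>n2\<close>, \<open>n1\<close>, where \<open>b\<close> stands for a bar, and each
  of the five admissible columns of height two by one of \<open>e\<close>, \<open>d\<close>, \<open>c\<close>, \<open>b\<close>, \<open>a\<close>.\<close>

definition kn_word ::
    "nat \<Rightarrow> nat \<Rightarrow> nat \<Rightarrow> nat \<Rightarrow> nat \<Rightarrow> nat \<Rightarrow> nat \<Rightarrow> nat \<Rightarrow> nat \<Rightarrow> letter list" where
  "kn_word n1b n2b n2 n1 e d c b a =
     word_power n1b [L1bar] @ word_power n2b [L2bar] @ word_power n2 [L2] @ word_power n1 [L1] @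
     word_power e [L2bar, L1bar] @ word_power d [L2, L1bar] @ word_power c [L2, L2bar] @
     word_power b [L1, L2bar] @ word_power a [L1, L2]"

text \<open>The conditions for these columns to form a semistandard tableau.\<close>

definition kn_valid :: "nat \<Rightarrow> nat \<Rightarrow> nat \<Rightarrow> nat \<Rightarrow> nat \<Rightarrow> bool" where
  "kn_valid n2 n1 e d c \<longleftrightarrow>
     c \<le> 1 \<and> (0 < e \<longrightarrow> n2 = 0 \<and> n1 = 0) \<and> (0 < d + c \<longrightarrow> n1 = 0)"

lemmas letter_eps_phi = letter_eps_def letter_phi_def

lemma block_eps_phi [simp]:
  "word_eps Node1 (word_power n [L1bar]) = n" "word_phi Node1 (word_power n [L1bar]) = 0"
  "word_eps Node1 (word_power n [L2bar]) = 0" "word_phi Node1 (word_power n [L2bar]) = n"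
  "word_eps Node1 (word_power n [L2]) = n" "word_phi Node1 (word_power n [L2]) = 0"
  "word_eps Node1 (word_power n [L1]) = 0" "word_phi Node1 (word_power n [L1]) = n"
  "word_eps Node1 (word_power n [L2bar, L1bar]) = 0" "word_phi Node1 (word_power n [L2bar, L1bar]) = 0"
  "word_eps Node1 (word_power n [L2, L1bar]) = 2 * n" "word_phi Node1 (word_power n [L2, L1bar]) = 0"
  "word_eps Node1 (word_power n [L1, L2bar]) = 0" "word_phi Node1 (word_power n [L1, L2bar]) = 2 * n"
  "word_eps Node1 (word_power n [L1, L2]) = 0" "word_phi Node1 (word_power n [L1, L2]) = 0"
  "word_eps Node2 (word_power n [L1bar]) = 0" "word_phi Node2 (word_power n [L1bar]) = 0"
  "word_eps Node2 (word_power n [L2bar]) = n" "word_phi Node2 (word_power n [L2bar]) = 0"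
  "word_eps Node2 (word_power n [L2]) = 0" "word_phi Node2 (word_power n [L2]) = n"
  "word_eps Node2 (word_power n [L1]) = 0" "word_phi Node2 (word_power n [L1]) = 0"
  "word_eps Node2 (word_power n [L2bar, L1bar]) = n" "word_phi Node2 (word_power n [L2bar, L1bar]) = 0"
  "word_eps Node2 (word_power n [L2, L1bar]) = 0" "word_phi Node2 (word_power n [L2, L1bar]) = n"
  "word_eps Node2 (word_power n [L2, L2bar]) = 0" "word_phi Node2 (word_power n [L2, L2bar]) = 0"
  "word_eps Node2 (word_power n [L1, L2bar]) = n" "word_phi Node2 (word_power n [L1, L2bar]) = 0"
  "word_eps Node2 (word_power n [L1, L2]) = 0" "word_phi Node2 (word_power n [L1, L2]) = n"
  by (simp_all add: word_eps_phi_power letter_eps_phi)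

text \<open>For node 1 this is the only block with both eps and phi nonzero, so
  \<open>word_eps_phi_power\<close> does not apply. Two copies would partly cancel; the bound on
  \<open>c\<close> keeps the formula linear.\<close>

lemma block_eps_phi_c [simp]:
  "c \<le> 1 \<Longrightarrow> word_eps Node1 (word_power c [L2, L2bar]) = c"
  "c \<le> 1 \<Longrightarrow> word_phi Node1 (word_power c [L2, L2bar]) = c"
  by (cases c; auto simp: letter_eps_phi)+

text \<open>A phi cancels an eps to its right: the \<open>n2b\<close> letters act against
  \<open>n2 + 2 * d + c\<close>. \<open>kn_valid\<close> forces \<open>n1 = 0\<close> if
  \<open>d + c\<close> is positive, so the letters \<open>L1\<close> cancel nothing. In
  \<open>kn_eps2\<close> it protects \<open>e\<close> from \<open>n2\<close> in the same
  way.\<close>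

lemma kn_eps1:
  assumes "kn_valid n2 n1 e d c"
  shows "word_eps Node1 (kn_word n1b n2b n2 n1 e d c b a) = n1b + (n2 + 2 * d + c - n2b)"
  using assms by (auto simp: kn_word_def kn_valid_def word_eps_append word_phi_append)

lemma kn_phi1:
  assumes "kn_valid n2 n1 e d c"
  shows "word_phi Node1 (kn_word n1b n2b n2 n1 e d c b a) =
    n1 + c + 2 * b + (n2b - (n2 + 2 * d + c))"
  using assms by (auto simp: kn_word_def kn_valid_def word_eps_append word_phi_append)

lemma kn_eps2:
  assumes "kn_valid n2 n1 e d c"
  shows "word_eps Node2 (kn_word n1b n2b n2 n1 e d c b a) = n2b + e + (b - (n2 + d))"
  using assms by (auto simp: kn_word_def kn_valid_def word_eps_append word_phi_append)

lemma kn_phi2: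
  assumes "kn_valid n2 n1 e d c"
  shows "word_phi Node2 (kn_word n1b n2b n2 n1 e d c b a) = a + (n2 + d - b)"
  using assms by (auto simp: kn_word_def kn_valid_def word_eps_append word_phi_append)

section \<open>Raising operators on tableau words\<close>

lemmas kn_e_simps = kn_word_def kn_valid_def word_e_append word_eps_append word_phi_append
  word_e_power_word letter_eps_phi option.map_comp o_def

text \<open>e_1 acts on the rightmost eps left after cancellation, and \<open>n2b\<close> cancels
  from the left. So the candidates are tried in the order \<open>c\<close>, \<open>d\<close>,
  \<open>n2\<close>, and \<open>n1b\<close> once all of these are cancelled.\<close>

lemma kn_e1_c:
  assumes "kn_valid n2 n1 e d 1" "n2b < n2 + 2 * d + 1"
  shows "word_e Node1 (kn_word n1b n2b n2 n1 e d 1 b a) =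
    Some (kn_word n1b n2b n2 n1 e d 0 (Suc b) a)"
  using assms by (simp add: kn_e_simps)

lemma kn_e1_d:
  assumes "kn_valid n2 n1 e (Suc d) 0" "n2b < n2 + 2 * Suc d"
  shows "word_e Node1 (kn_word n1b n2b n2 n1 e (Suc d) 0 b a) =
    Some (kn_word n1b n2b n2 n1 e d 1 b a)"
  \<comment> \<open>The powers stay folded in the first call so that
    \<open>word_e_power_word\<close> matches; the second call unfolds the copy that has joined the
    next block.\<close>
  using assms by (simp add: kn_e_simps del: word_power_simps(2)) (simp add: kn_e_simps)

lemma kn_e1_n2:
  assumes "kn_valid (Suc n2) n1 e 0 0" "n2b < Suc n2"
  shows "word_e Node1 (kn_word n1b n2b (Suc n2) n1 e 0 0 b a) =
    Some (kn_word n1b n2b n2 (Suc n1) e 0 0 b a)"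
  using assms by (simp add: kn_e_simps del: word_power_simps(2)) (simp add: kn_e_simps)

lemma kn_e1_n1b:
  assumes "kn_valid n2 n1 e d c" "n2 + 2 * d + c \<le> n2b"
  shows "word_e Node1 (kn_word (Suc n1b) n2b n2 n1 e d c b a) =
    Some (kn_word n1b (Suc n2b) n2 n1 e d c b a)"
  using assms by (simp add: kn_e_simps del: word_power_simps(2)) (simp add: kn_e_simps)

text \<open>For node 2 only the surplus of \<open>b\<close> over \<open>n2 + d\<close> survives
  cancellation, and it lies furthest to the right. After it come \<open>e\<close> and then
  \<open>n2b\<close>.\<close>

lemma kn_e2_b:
  assumes "kn_valid n2 n1 e d c" "n2 + d \<le> b"
  shows "word_e Node2 (kn_word n1b n2b n2 n1 e d c (Suc b) a) =
    Some (kn_word n1b n2b n2 n1 e d c b (Suc a))"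
  using assms by (simp add: kn_e_simps del: word_power_simps(2)) (simp add: kn_e_simps)

lemma kn_e2_e:
  assumes "kn_valid n2 n1 (Suc e) d c" "b \<le> n2 + d"
  shows "word_e Node2 (kn_word n1b n2b n2 n1 (Suc e) d c b a) =
    Some (kn_word n1b n2b n2 n1 e (Suc d) c b a)"
  using assms by (simp add: kn_e_simps del: word_power_simps(2)) (simp add: kn_e_simps)

lemma kn_e2_n2b:
  assumes "kn_valid n2 n1 0 d c" "b \<le> n2 + d"
  shows "word_e Node2 (kn_word n1b (Suc n2b) n2 n1 0 d c b a) =
    Some (kn_word n1b n2b (Suc n2) n1 0 d c b a)"
  using assms by (simp add: kn_e_simps del: word_power_simps(2)) (simp add: kn_e_simps)

section \<open>Maximal strings and \<open>str2\<close> of tableau words\<close>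

lemma kn_e_max2_b:
  assumes "kn_valid n2 n1 e d c"
  shows "word_e_max Node2 (kn_word n1b n2b n2 n1 e d c (n2 + d + k) a) =
    word_e_max Node2 (kn_word n1b n2b n2 n1 e d c (n2 + d) (a + k))"
proof (induction k arbitrary: a)
  case (Suc k)
  then show ?case
    using word_e_max_Some[OF kn_e2_b[OF assms, of "n2 + d + k"]] by simp
qed simp

lemma kn_e_max2_e:
  assumes "kn_valid n2 n1 e d c" "b \<le> n2 + d"
  shows "word_e_max Node2 (kn_word n1b n2b n2 n1 e d c b a) =
    word_e_max Node2 (kn_word n1b n2b n2 n1 0 (d + e) c b a)"
  using assms
proof (induction e arbitrary: d)
  case (Suc e)
  have "kn_valid n2 n1 e (Suc d) c" using Suc.prems by (auto simp: kn_valid_def)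
  then show ?case
    using word_e_max_Some[OF kn_e2_e[OF Suc.prems]] Suc.IH[of "Suc d"] Suc.prems by simp
qed simp

lemma kn_e_max2_n2b:
  assumes "kn_valid n2 n1 0 d c" "b \<le> n2 + d"
  shows "word_e_max Node2 (kn_word n1b n2b n2 n1 0 d c b a) =
    kn_word n1b 0 (n2 + n2b) n1 0 d c b a"
  using assms
proof (induction n2b arbitrary: n2)
  case 0
  then show ?case
    using kn_eps2[OF 0(1)] by (simp add: word_e_max_None word_e_eq_None_iff)
next
  case (Suc n2b)
  have "kn_valid (Suc n2) n1 0 d c" using Suc.prems by (auto simp: kn_valid_def)
  then show ?case
    using word_e_max_Some[OF kn_e2_n2b[OF Suc.prems]] Suc.IH[of "Suc n2"] Suc.prems by simp
qed

lemma kn_e_max2: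
  assumes "kn_valid n2 n1 e d c"
  shows "word_e_max Node2 (kn_word n1b n2b n2 n1 e d c b a) =
    kn_word n1b 0 (n2 + n2b) n1 0 (d + e) c (min b (n2 + d)) (a + (b - (n2 + d)))"
proof -
  have "word_e_max Node2 (kn_word n1b n2b n2 n1 e d c b a) =
      word_e_max Node2 (kn_word n1b n2b n2 n1 e d c (min b (n2 + d)) (a + (b - (n2 + d))))"
    using kn_e_max2_b[OF assms, of n1b n2b "b - (n2 + d)" a]
    by (cases "b \<le> n2 + d") (auto simp: min_def)
  also have "\<dots> = word_e_max Node2
      (kn_word n1b n2b n2 n1 0 (d + e) c (min b (n2 + d)) (a + (b - (n2 + d))))"
    by (rule kn_e_max2_e) (use assms in auto)
  also have "\<dots> = kn_word n1b 0 (n2 + n2b) n1 0 (d + e) c (min b (n2 + d)) (a + (b - (n2 + d)))"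
    by (rule kn_e_max2_n2b) (use assms in \<open>auto simp: kn_valid_def\<close>)
  finally show ?thesis .
qed

text \<open>Each column \<open>[L2, L1bar]\<close> takes two steps, through
  \<open>[L2, L2bar]\<close>. The value 0 for \<open>n2b\<close>, which a maximal 2-string leaves
  behind, excludes cancellation.\<close>

lemma kn_e_max1_d:
  assumes "kn_valid n2 n1 e d 0"
  shows "word_e_max Node1 (kn_word n1b 0 n2 n1 e d 0 b a) =
    word_e_max Node1 (kn_word n1b 0 n2 n1 e 0 0 (b + d) a)"
  using assms
proof (induction d arbitrary: b)
  case (Suc d)
  have valid: "kn_valid n2 n1 e d 1" "kn_valid n2 n1 e d 0"
    using Suc.prems by (auto simp: kn_valid_def)
  have "word_e_max Node1 (kn_word n1b 0 n2 n1 e (Suc d) 0 b a) =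
      word_e_max Node1 (kn_word n1b 0 n2 n1 e d 0 (Suc b) a)"
    using word_e_max_Some[OF kn_e1_d[OF Suc.prems]] word_e_max_Some[OF kn_e1_c[OF valid(1)]]
    by simp
  then show ?case using Suc.IH[OF valid(2), of "Suc b"] by simp
qed simp

lemma kn_e_max1_c:
  assumes "kn_valid n2 n1 e d c"
  shows "word_e_max Node1 (kn_word n1b 0 n2 n1 e d c b a) =
    word_e_max Node1 (kn_word n1b 0 n2 n1 e 0 0 (b + d + c) a)"
proof (cases c)
  case 0
  with assms show ?thesis using kn_e_max1_d by simp
next
  case (Suc k)
  with assms have c: "c = 1" and valid: "kn_valid n2 n1 e d 0" by (auto simp: kn_valid_def)
  then show ?thesis
    using word_e_max_Some[OF kn_e1_c[OF assms[unfolded c]], of 0 n1b b a] kn_e_max1_d[OF valid]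
    by simp
qed

lemma kn_e_max1_n2:
  assumes "kn_valid n2 n1 e 0 0"
  shows "word_e_max Node1 (kn_word n1b 0 n2 n1 e 0 0 b a) =
    word_e_max Node1 (kn_word n1b 0 0 (n1 + n2) e 0 0 b a)"
  using assms
proof (induction n2 arbitrary: n1)
  case (Suc n2)
  have "kn_valid n2 (Suc n1) e 0 0" using Suc.prems by (auto simp: kn_valid_def)
  then show ?case
    using word_e_max_Some[OF kn_e1_n2[OF Suc.prems]] Suc.IH[of "Suc n1"] by simp
qed simp

lemma kn_e_max1_n1b:
  assumes "kn_valid 0 n1 e 0 0"
  shows "word_e_max Node1 (kn_word n1b n2b 0 n1 e 0 0 b a) =
    kn_word 0 (n1b + n2b) 0 n1 e 0 0 b a"
proof (induction n1b arbitrary: n2b)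
  case 0
  then show ?case
    using kn_eps1[OF assms] by (simp add: word_e_max_None word_e_eq_None_iff)
next
  case (Suc n1b)
  show ?case
    using word_e_max_Some[OF kn_e1_n1b[OF assms]] Suc.IH[of "Suc n2b"] by simp
qed

lemma kn_e_max1:
  assumes "kn_valid n2 n1 e d c"
  shows "word_e_max Node1 (kn_word n1b 0 n2 n1 e d c b a) =
    kn_word 0 n1b 0 (n1 + n2) e 0 0 (b + d + c) a"
proof -
  have valid: "kn_valid n2 n1 e 0 0" "kn_valid 0 (n1 + n2) e 0 0"
    using assms by (auto simp: kn_valid_def)
  show ?thesis
    using kn_e_max1_c[OF assms] kn_e_max1_n2[OF valid(1)] kn_e_max1_n1b[OF valid(2)] by simp
qed

definition word_e_max_2121 :: "letter list \<Rightarrow> letter list" where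
  "word_e_max_2121 T =
     word_e_max Node1 (word_e_max Node2 (word_e_max Node1 (word_e_max Node2 T)))"

text \<open>The four runs empty the multiplicities in turn: \<open>n2b\<close> and \<open>e\<close>;
  then \<open>n1b\<close>, \<open>n2\<close>, \<open>d\<close>, \<open>c\<close>, where the letters
  \<open>L1bar\<close> reappear as \<open>L2bar\<close>; then \<open>n2b\<close> and
  \<open>b\<close>; then \<open>n2\<close>. Only \<open>L1\<close> and \<open>[L1, L2]\<close>
  remain.\<close>

lemma kn_str2:
  assumes "kn_valid n2 n1 e d c"
  shows "str2 (kn_word n1b n2b n2 n1 e d c b a) =
      (n2b + e + (b - (n2 + d)), n1b + n2b + n2 + 2 * (d + e) + c,
       n1b + min b (n2 + d) + d + e + c, n1b)" (is ?str)
    and "word_e_max_2121 (kn_word n1b n2b n2 n1 e d c b a) =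
      kn_word 0 0 0 (n1b + n2b + n2 + n1) 0 0 0 0 (e + d + c + b + a)" (is ?high)
proof -
  have valid: "kn_valid (n2 + n2b) n1 0 (d + e) c" "kn_valid 0 k 0 0 0" "kn_valid l k 0 0 0" for k l
    using assms by (auto simp: kn_valid_def)
  show ?str
    by (simp add: str2_def Let_def kn_e_max2[OF assms] kn_e_max1[OF valid(1)]
        kn_e_max2[OF valid(2)] kn_eps2[OF assms] kn_eps1[OF valid(1)] kn_eps2[OF valid(2)]
        kn_eps1[OF valid(3)])
  show ?high
    by (simp add: word_e_max_2121_def kn_e_max2[OF assms] kn_e_max1[OF valid(1)]
        kn_e_max2[OF valid(2)] kn_e_max1[OF valid(3)] add_ac min_def)
qed

section \<open>The crystal as the set of tableau words\<close>

definition kn_words :: "weight \<Rightarrow> letter list set" where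
  "kn_words la = {kn_word n1b n2b n2 n1 e d c b a | n1b n2b n2 n1 e d c b a.
     kn_valid n2 n1 e d c \<and> int (n1b + n2b + n2 + n1) = fst la \<and>
     int (e + d + c + b + a) = snd la}"

lemma kn_wordsI:
  assumes "kn_valid n2 n1 e d c" "int (n1b + n2b + n2 + n1) = fst la"
    "int (e + d + c + b + a) = snd la"
  shows "kn_word n1b n2b n2 n1 e d c b a \<in> kn_words la"
  using assms unfolding kn_words_def by blast

lemma kn_words_cases:
  assumes "T \<in> kn_words la"
  obtains n1b n2b n2 n1 e d c b a where "T = kn_word n1b n2b n2 n1 e d c b a"
    "kn_valid n2 n1 e d c" "int (n1b + n2b + n2 + n1) = fst la"
    "int (e + d + c + b + a) = snd la"
  using assms unfolding kn_words_def by blast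

lemma highest_word_kn:
  "highest_word la = kn_word 0 0 0 (nat (fst la)) 0 0 0 0 (nat (snd la))"
proof -
  have "concat (replicate n [x]) = replicate n x" for n and x :: letter
    by (induction n) auto
  then show ?thesis by (simp add: highest_word_def kn_word_def word_power_def)
qed

lemma kn_words_e:
  assumes "T \<in> kn_words la" "word_e i T = Some U"
  shows "U \<in> kn_words la"
proof -
  from assms(1) obtain n1b n2b n2 n1 e d c b a where T: "T = kn_word n1b n2b n2 n1 e d c b a"
    and valid: "kn_valid n2 n1 e d c"
    and la: "int (n1b + n2b + n2 + n1) = fst la" "int (e + d + c + b + a) = snd la"
    by (rule kn_words_cases)
  have eps: "word_eps i T > 0" using assms(2) word_e_eq_None_iff[of i T] by auto
  show ?thesis
  proof (cases i)
    case Node1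
    have "0 < n1b + (n2 + 2 * d + c - n2b)" "c \<le> 1"
      using eps kn_eps1[OF valid, of n1b n2b b a] valid by (simp_all add: T Node1 kn_valid_def)
    then have "(c = 1 \<and> n2b < n2 + 2 * d + 1) \<or> (c = 0 \<and> 0 < d \<and> n2b < n2 + 2 * d) \<or>
        (c = 0 \<and> d = 0 \<and> 0 < n2 \<and> n2b < n2) \<or> (0 < n1b \<and> n2 + 2 * d + c \<le> n2b)"
      by arith
    then consider "c = 1" "n2b < n2 + 2 * d + 1"
      | d' where "c = 0" "d = Suc d'" "n2b < n2 + 2 * d"
      | n2' where "c = 0" "d = 0" "n2 = Suc n2'" "n2b < n2"
      | n1b' where "n1b = Suc n1b'" "n2 + 2 * d + c \<le> n2b"
      unfolding gr0_conv_Suc by blast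
    then show ?thesis
    proof cases
      case 1
      have "U = kn_word n1b n2b n2 n1 e d 0 (Suc b) a"
        using kn_e1_c[of n2 n1 e d n2b n1b b a] valid assms(2) 1 by (simp add: T Node1)
      with la valid 1 show ?thesis by (auto intro!: kn_wordsI simp: kn_valid_def)
    next
      case 2
      have "U = kn_word n1b n2b n2 n1 e d' 1 b a"
        using kn_e1_d[of n2 n1 e d' n2b n1b b a] valid assms(2) 2 by (simp add: T Node1)
      with la valid 2 show ?thesis by (auto intro!: kn_wordsI simp: kn_valid_def)
    next
      case 3
      have "U = kn_word n1b n2b n2' (Suc n1) e 0 0 b a"
        using kn_e1_n2[of n2' n1 e n2b n1b b a] valid assms(2) 3 by (simp add: T Node1)
      with la valid 3 show ?thesis by (auto intro!: kn_wordsI simp: kn_valid_def)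
    next
      case 4
      have "U = kn_word n1b' (Suc n2b) n2 n1 e d c b a"
        using kn_e1_n1b[of n2 n1 e d c n2b n1b' b a] valid assms(2) 4 by (simp add: T Node1)
      with la valid 4 show ?thesis by (auto intro!: kn_wordsI simp: kn_valid_def)
    qed
  next
    case Node2
    consider b' where "b = Suc b'" "n2 + d \<le> b'"
      | e' where "e = Suc e'" "b \<le> n2 + d"
      | n2b' where "e = 0" "n2b = Suc n2b'" "b \<le> n2 + d"
      using eps kn_eps2[OF valid, of n1b n2b b a] unfolding T Node2
      by (cases b; cases e; cases n2b; cases "b \<le> n2 + d") auto
    then show ?thesis
    proof cases
      case 1
      have "U = kn_word n1b n2b n2 n1 e d c b' (Suc a)"
        using kn_e2_b[OF valid, of b' n1b n2b a] assms(2) 1 by (simp add: T Node2)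
      with la valid 1 show ?thesis by (auto intro!: kn_wordsI simp: kn_valid_def)
    next
      case 2
      have "U = kn_word n1b n2b n2 n1 e' (Suc d) c b a"
        using kn_e2_e[of n2 n1 e' d c b n1b n2b a] valid assms(2) 2 by (simp add: T Node2)
      with la valid 2 show ?thesis by (auto intro!: kn_wordsI simp: kn_valid_def)
    next
      case 3
      have "U = kn_word n1b n2b' (Suc n2) n1 0 d c b a"
        using kn_e2_n2b[of n2 n1 d c b n1b n2b' a] valid assms(2) 3 by (simp add: T Node2)
      with la valid 3 show ?thesis by (auto intro!: kn_wordsI simp: kn_valid_def)
    qed
  qed
qed

text \<open>The formulas for e_i read backwards: in each case a word \<open>V\<close> with
  \<open>word_e i V = Some T\<close> is exhibited, and it must be \<open>U\<close>.\<close>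

lemma kn_words_f:
  assumes "T \<in> kn_words la" "word_f i T = Some U"
  shows "U \<in> kn_words la"
proof -
  from assms(1) obtain n1b n2b n2 n1 e d c b a where T: "T = kn_word n1b n2b n2 n1 e d c b a"
    and valid: "kn_valid n2 n1 e d c"
    and la: "int (n1b + n2b + n2 + n1) = fst la" "int (e + d + c + b + a) = snd la"
    by (rule kn_words_cases)
  have phi: "word_phi i T > 0" using assms(2) word_f_eq_None_iff[of i T] by auto
  have U: "U = V" if "word_e i V = Some T" for V
    using that assms(2) word_e_eq_Some_iff by fastforce
  show ?thesis
  proof (cases i)
    case Node1
    have "0 < n1 + c + 2 * b + (n2b - (n2 + 2 * d + c))" "c \<le> 1" "0 < n1 \<longrightarrow> c = 0 \<and> d = 0 \<and> e = 0"
      using phi kn_phi1[OF valid, of n1b n2b b a] valid by (auto simp: T Node1 kn_valid_def)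
    then have "(0 < n2b \<and> n2 + 2 * d + c \<le> n2b - 1) \<or>
        (0 < n1 \<and> n2b \<le> n2 \<and> c = 0 \<and> d = 0 \<and> e = 0) \<or> (c = 1 \<and> n2b \<le> n2 + 2 * d + 1) \<or>
        (c = 0 \<and> 0 < b \<and> n1 = 0 \<and> n2b \<le> n2 + 2 * d)"
      by arith
    then consider n2b' where "n2b = Suc n2b'" "n2 + 2 * d + c \<le> n2b'"
      | n1' where "n1 = Suc n1'" "n2b \<le> n2" "c = 0" "d = 0" "e = 0"
      | "c = 1" "n2b \<le> n2 + 2 * d + 1"
      | b' where "c = 0" "b = Suc b'" "n1 = 0" "n2b \<le> n2 + 2 * d"
      unfolding gr0_conv_Suc by (metis diff_Suc_1)
    then show ?thesis
    proof cases
      case 1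
      have "U = kn_word (Suc n1b) n2b' n2 n1 e d c b a"
        using kn_e1_n1b[of n2 n1 e d c n2b' n1b b a] valid 1 by (intro U) (simp add: T Node1)
      with la valid 1 show ?thesis by (auto intro!: kn_wordsI simp: kn_valid_def)
    next
      case 2
      have "kn_valid (Suc n2) n1' e 0 0" using valid 2 by (auto simp: kn_valid_def)
      then have "U = kn_word n1b n2b (Suc n2) n1' e 0 0 b a"
        using kn_e1_n2[of n2 n1' e n2b n1b b a] 2 by (intro U) (simp add: T Node1)
      with la valid 2 show ?thesis by (auto intro!: kn_wordsI simp: kn_valid_def)
    next
      case 3
      have "kn_valid n2 n1 e (Suc d) 0" using valid 3 by (auto simp: kn_valid_def)
      then have "U = kn_word n1b n2b n2 n1 e (Suc d) 0 b a"
        using kn_e1_d[of n2 n1 e d n2b n1b b a] 3 by (intro U) (simp add: T Node1)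
      with la valid 3 show ?thesis by (auto intro!: kn_wordsI simp: kn_valid_def)
    next
      case 4
      have "kn_valid n2 n1 e d 1" using valid 4 by (auto simp: kn_valid_def)
      then have "U = kn_word n1b n2b n2 n1 e d 1 b' a"
        using kn_e1_c[of n2 n1 e d n2b n1b b' a] 4 by (intro U) (simp add: T Node1)
      with la valid 4 show ?thesis by (auto intro!: kn_wordsI simp: kn_valid_def)
    qed
  next
    case Node2
    consider n2' where "n2 = Suc n2'" "b \<le> n2' + d" "e = 0"
      | d' where "n2 = 0" "d = Suc d'" "b \<le> d'"
      | a' where "a = Suc a'" "n2 + d \<le> b"
      using phi valid kn_phi2[OF valid, of n1b n2b b a] unfolding T Node2 kn_valid_def
      by (cases n2; cases d; cases a; cases "n2 + d \<le> b") auto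
    then show ?thesis
    proof cases
      case 1
      have "kn_valid n2' n1 0 d c" using valid 1 by (auto simp: kn_valid_def)
      then have "U = kn_word n1b (Suc n2b) n2' n1 0 d c b a"
        using kn_e2_n2b[of n2' n1 d c b n1b n2b a] 1 by (intro U) (simp add: T Node2)
      with la valid 1 show ?thesis by (auto intro!: kn_wordsI simp: kn_valid_def)
    next
      case 2
      have "kn_valid n2 n1 (Suc e) d' c" using valid 2 by (auto simp: kn_valid_def)
      then have "U = kn_word n1b n2b n2 n1 (Suc e) d' c b a"
        using kn_e2_e[of n2 n1 e d' c b n1b n2b a] 2 by (intro U) (simp add: T Node2)
      with la valid 2 show ?thesis by (auto intro!: kn_wordsI simp: kn_valid_def)
    next
      case 3
      have "U = kn_word n1b n2b n2 n1 e d c (Suc b) a'"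
        using kn_e2_b[OF valid, of b n1b n2b a'] 3 by (intro U) (simp add: T Node2)
      with la valid 3 show ?thesis by (auto intro!: kn_wordsI simp: kn_valid_def)
    qed
  qed
qed

lemma kn_words_e_max:
  assumes "T \<in> kn_words la"
  shows "word_e_max_2121 T = highest_word la"
proof -
  from assms obtain n1b n2b n2 n1 e d c b a where T: "T = kn_word n1b n2b n2 n1 e d c b a"
    and valid: "kn_valid n2 n1 e d c"
    and la: "int (n1b + n2b + n2 + n1) = fst la" "int (e + d + c + b + a) = snd la"
    by (rule kn_words_cases)
  show ?thesis
    by (simp add: T kn_str2(2)[OF valid] highest_word_kn la[symmetric] del: of_nat_add)
qed

text \<open>Tableau words contain the highest word and are stable under e_i and f_i. Conversely each
  of them is raised to the highest word, and the crystal is closed under the way back.\<close>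

theorem crystal_eq_kn_words:
  assumes "la \<in> X_plus"
  shows "crystal la = kn_words la"
proof
  show "crystal la \<subseteq> kn_words la"
  proof
    fix T
    assume "T \<in> crystal la"
    then show "T \<in> kn_words la"
    proof induction
      case crystal_highest
      show ?case
        unfolding highest_word_kn
        by (rule kn_wordsI) (use assms in \<open>auto simp: kn_valid_def X_plus_def\<close>)
    qed (blast intro: kn_words_e kn_words_f)+
  qed
  show "kn_words la \<subseteq> crystal la"
  proof
    fix T
    assume "T \<in> kn_words la"
    then have "word_e_max_2121 T \<in> crystal la"
      using kn_words_e_max crystal_highest by simp
    then show "T \<in> crystal la" by (simp add: word_e_max_2121_def crystal_word_e_max)
  qed
qed

lemma finite_crystal: "finite (crystal la)"
proof -
  have f: "length ys = length xs" if "word_f i xs = Some ys" for i xs ys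
    using that by (induction xs arbitrary: ys) (auto split: if_splits)
  have e: "length ys = length xs" if "word_e i xs = Some ys" for i xs ys
    using that f word_e_eq_Some_iff by metis
  have "length T = length (highest_word la)" if "T \<in> crystal la" for T
    using that by induction (auto dest: e f)
  moreover have "set T \<subseteq> {L1, L2, L2bar, L1bar}" for T
  proof
    fix x
    show "x \<in> {L1, L2, L2bar, L1bar}" by (cases x) auto
  qed
  ultimately have "crystal la \<subseteq>
      {xs. set xs \<subseteq> {L1, L2, L2bar, L1bar} \<and> length xs = length (highest_word la)}"
    by blast
  then show ?thesis by (rule finite_subset) (simp add: finite_lists_length_eq)
qed

text \<open>An element without raising steps is fixed by \<open>word_e_max_2121\<close>, whose only
  value on the crystal is the highest word.\<close>

lemma crystal_highest_unique:
  assumes "la \<in> X_plus" "T \<in> crystal la" "\<And>i. word_eps i T = 0"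
  shows "T = highest_word la"
proof -
  have "word_e_max i T = T" for i using assms(3) by (simp add: word_e_max_None word_e_eq_None_iff)
  then have "word_e_max_2121 T = T" by (simp add: word_e_max_2121_def)
  then show ?thesis using assms kn_words_e_max crystal_eq_kn_words by metis
qed

text \<open>Both paths end in the highest word, and the string lengths allow them to be retraced by
  \<open>word_e_max_inject\<close>.\<close>

lemma str2_inject:
  assumes "la \<in> X_plus" "T \<in> crystal la" "U \<in> crystal la" "str2 T = str2 U"
  shows "T = U"
proof -
  have "word_e_max_2121 T = word_e_max_2121 U"
    using assms by (simp add: kn_words_e_max crystal_eq_kn_words)
  with assms(4) show ?thesis
    unfolding str2_def word_e_max_2121_def Let_def prod.inject
    by (metis word_e_max_inject)
qed

section \<open>Weights of strings and the embedding \<open>Phi\<close>\<close>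

lemma word_wt_highest_word:
  assumes "la \<in> X_plus"
  shows "word_wt (highest_word la) = la"
proof -
  have 1: "word_wt (replicate n L1) = (int n, 0)" for n
    by (induction n) (auto simp: zero_prod_def)
  have 2: "word_wt (concat (replicate n [L1, L2])) = (0, int n)" for n
    by (induction n) (auto simp: zero_prod_def)
  show ?thesis using assms by (auto simp: highest_word_def 1 2 X_plus_def prod_eq_iff)
qed

lemma word_wt_str2:
  assumes "la \<in> X_plus" "T \<in> crystal la" "str2 T = (a, b, c, d)"
  shows "la = word_wt T + wscale (int (b + d)) (simple_root Node1) +
    wscale (int (a + c)) (simple_root Node2)"
proof -
  have "la = word_wt (word_e_max_2121 T)"
    using assms by (simp add: kn_words_e_max crystal_eq_kn_words word_wt_highest_word)
  then show ?thesis
    using assms(3)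
    by (auto simp: word_e_max_2121_def word_wt_word_e_max str2_def Let_def wscale_def prod_eq_iff
        algebra_simps)
qed

lemma dominance_le_crystal:
  assumes "la \<in> X_plus" "T \<in> crystal la"
  shows "dominance_le (word_wt T) la"
proof -
  obtain a b c d where str: "str2 T = (a, b, c, d)" by (metis prod_cases4)
  have "la - word_wt T = wscale (int (b + d)) (simple_root Node1) +
      wscale (int (a + c)) (simple_root Node2)"
    by (subst word_wt_str2[OF assms str]) (simp add: algebra_simps)
  then show ?thesis unfolding dominance_le_def by blast
qed

lemma ex_crystal_str2_shift:
  assumes "la \<in> X_plus" "T \<in> crystal la"
  shows "\<exists>T' \<in> crystal (la + wscale 2 varpi1). str2 T' = str2 T + (0, 1, 1, 1)"
proof -
  let ?la = "la + wscale 2 varpi1"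
  have "?la \<in> X_plus" using assms(1) by (auto simp: X_plus_def varpi1_def wscale_def)
  then have crystal: "crystal ?la = kn_words ?la" by (rule crystal_eq_kn_words)
  from assms have "T \<in> kn_words la" by (simp add: crystal_eq_kn_words)
  then obtain n1b n2b n2 n1 e d c b a where T: "T = kn_word n1b n2b n2 n1 e d c b a"
    and valid: "kn_valid n2 n1 e d c"
    and la: "int (n1b + n2b + n2 + n1) = fst la" "int (e + d + c + b + a) = snd la"
    by (rule kn_words_cases)
  \<comment> \<open>The second minus the fourth entry of the string,
    \<open>n2b + n2 + 2 * (d + e) + c\<close>, has to stay fixed. An extra \<open>L1\<close> does
    not enter it but is admissible only in the first case. Otherwise the extra letter is
    \<open>L2bar\<close> if \<open>e\<close> is positive and \<open>L2\<close> if not, and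
    \<open>2 * (d + e) + c\<close> must drop by one, which toggles \<open>c\<close>.\<close>
  consider "e = 0" "d = 0" "c = 0"
    | e' where "e = Suc e'" "c = 0" "n2 = 0" "n1 = 0"
    | e' where "e = Suc e'" "c = 1" "n2 = 0" "n1 = 0"
    | "e = 0" "c = 1" "n1 = 0"
    | d' where "e = 0" "c = 0" "d = Suc d'" "n1 = 0"
    using valid unfolding kn_valid_def by (cases e; cases d; cases "c = 1") auto
  \<comment> \<open>The witnesses are found by solving the formula of \<open>kn_str2\<close> for the multiplicities: the
    preimage of \<open>str2 T + (0, 1, 1, 1)\<close> has one more letter \<open>L1bar\<close>, one more letter of another
    kind, and the same number of columns.\<close>
  then show ?thesis
    unfolding crystal T
  proof cases
    case 1
    have v: "kn_valid n2 (Suc n1) 0 0 0" using valid 1 by (auto simp: kn_valid_def)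
    have "kn_word (Suc n1b) n2b n2 (Suc n1) 0 0 0 b a \<in> kn_words ?la"
      by (rule kn_wordsI[OF v]) (use la 1 in \<open>simp_all add: varpi1_def wscale_def\<close>)
    then show "\<exists>T' \<in> kn_words ?la. str2 T' = str2 (kn_word n1b n2b n2 n1 e d c b a) + (0, 1, 1, 1)"
      by (rule bexI[rotated]) (simp add: kn_str2(1)[OF valid[unfolded 1 One_nat_def]]
          kn_str2(1)[OF v[unfolded 1 One_nat_def]] 1)
  next
    case (2 e')
    have v: "kn_valid n2 n1 e' d 1" using valid 2 by (auto simp: kn_valid_def)
    have "kn_word (Suc n1b) (Suc n2b) n2 n1 e' d 1 b a \<in> kn_words ?la"
      by (rule kn_wordsI[OF v]) (use la 2 in \<open>simp_all add: varpi1_def wscale_def\<close>)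
    then show "\<exists>T' \<in> kn_words ?la. str2 T' = str2 (kn_word n1b n2b n2 n1 e d c b a) + (0, 1, 1, 1)"
      by (rule bexI[rotated]) (simp add: kn_str2(1)[OF valid[unfolded 2 One_nat_def]]
          kn_str2(1)[OF v[unfolded 2 One_nat_def]] 2)
  next
    case (3 e')
    have v: "kn_valid n2 n1 e' (Suc d) 0" using valid 3 by (auto simp: kn_valid_def)
    have "kn_word (Suc n1b) (Suc n2b) n2 n1 e' (Suc d) 0 (Suc b) a \<in> kn_words ?la"
      by (rule kn_wordsI[OF v]) (use la 3 in \<open>simp_all add: varpi1_def wscale_def\<close>)
    then show "\<exists>T' \<in> kn_words ?la. str2 T' = str2 (kn_word n1b n2b n2 n1 e d c b a) + (0, 1, 1, 1)"
      by (rule bexI[rotated]) (simp add: kn_str2(1)[OF valid[unfolded 3 One_nat_def]]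
          kn_str2(1)[OF v[unfolded 3 One_nat_def]] 3)
  next
    case 4
    have v: "kn_valid (Suc n2) n1 0 d 0" using valid 4 by (auto simp: kn_valid_def)
    have "kn_word (Suc n1b) n2b (Suc n2) n1 0 d 0 (Suc b) a \<in> kn_words ?la"
      by (rule kn_wordsI[OF v]) (use la 4 in \<open>simp_all add: varpi1_def wscale_def\<close>)
    then show "\<exists>T' \<in> kn_words ?la. str2 T' = str2 (kn_word n1b n2b n2 n1 e d c b a) + (0, 1, 1, 1)"
      by (rule bexI[rotated]) (simp add: kn_str2(1)[OF valid[unfolded 4 One_nat_def]]
          kn_str2(1)[OF v[unfolded 4 One_nat_def]] 4)
  next
    case (5 d')
    have v: "kn_valid (Suc n2) n1 0 d' 1" using valid 5 by (auto simp: kn_valid_def)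
    have "kn_word (Suc n1b) n2b (Suc n2) n1 0 d' 1 b a \<in> kn_words ?la"
      by (rule kn_wordsI[OF v]) (use la 5 in \<open>simp_all add: varpi1_def wscale_def\<close>)
    then show "\<exists>T' \<in> kn_words ?la. str2 T' = str2 (kn_word n1b n2b n2 n1 e d c b a) + (0, 1, 1, 1)"
      by (rule bexI[rotated]) (simp add: kn_str2(1)[OF valid[unfolded 5 One_nat_def]]
          kn_str2(1)[OF v[unfolded 5 One_nat_def]] 5)
  qed
qed

text \<open>\<open>str2_inject\<close> makes the description in \<open>Phi\<close> unique. In
  \<open>word_wt_str2\<close> the shift adds 2 \<alpha>1 + \<alpha>2 = 2 \<varpi>1, the same as the
  change of highest weight.\<close>

lemma Phi:
  assumes "la \<in> X_plus" "T \<in> crystal la"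
  shows Phi_in_crystal: "Phi la T \<in> crystal (la + wscale 2 varpi1)"
    and str2_Phi: "str2 (Phi la T) = str2 T + (0, 1, 1, 1)"
    and word_wt_Phi: "word_wt (Phi la T) = word_wt T"
proof -
  let ?la = "la + wscale 2 varpi1"
  have la: "?la \<in> X_plus" using assms(1) by (auto simp: X_plus_def varpi1_def wscale_def)
  have "\<exists>!T'. T' \<in> crystal ?la \<and> str2 T' = str2 T + (0, 1, 1, 1)"
    using ex_crystal_str2_shift[OF assms] str2_inject[OF la] by metis
  from theI'[OF this] show 1: "Phi la T \<in> crystal ?la" and 2: "str2 (Phi la T) = str2 T + (0, 1, 1, 1)"
    by (simp_all add: Phi_def)
  obtain a b c d where str: "str2 T = (a, b, c, d)" by (metis prod_cases4)
  with 2 have "str2 (Phi la T) = (a, b + 1, c + 1, d + 1)" by simp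
  note eqs = word_wt_str2[OF la 1 this] word_wt_str2[OF assms str]
  show "word_wt (Phi la T) = word_wt T"
    using eqs[THEN arg_cong, of fst] eqs[THEN arg_cong, of snd]
    by (simp add: wscale_def varpi1_def prod_eq_iff algebra_simps)
qed

lemma inj_on_Phi:
  assumes "la \<in> X_plus"
  shows "inj_on (Phi la) (crystal la)"
  by (rule inj_onI) (metis str2_inject[OF assms] str2_Phi[OF assms] add_right_cancel)

section \<open>Crystal reflections and the character formula\<close>

lemma word_eps_word_e_max: "word_eps i (word_e_max i xs) = 0"
  by (induction xs rule: word_e_max_induct[of i])
    (simp_all add: word_e_max_None word_e_max_Some word_e_eq_None_iff)

lemma word_phi_word_e_max: "word_phi i (word_e_max i xs) = word_eps i xs + word_phi i xs"
proof (induction xs rule: word_e_max_induct[of i])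
  case (None xs)
  then show ?case using word_e_eq_None_iff[of i xs] by (simp add: word_e_max_None)
next
  case (Some xs ys)
  then show ?case by (simp add: word_e_max_Some word_eps_word_e word_phi_word_e)
qed

lemma word_e_max_idem: "word_e_max i (word_e_max i xs) = word_e_max i xs"
  by (simp add: word_e_max_None word_e_eq_None_iff word_eps_word_e_max)

lemma ex_word_in_string:
  assumes "k \<le> word_eps i xs + word_phi i xs"
  shows "\<exists>ys. word_e_max i ys = word_e_max i xs \<and> word_eps i ys = k"
  using assms
proof (induction k)
  case 0
  show ?case using word_e_max_idem word_eps_word_e_max by blast
next
  case (Suc k)
  then obtain ys where ys: "word_e_max i ys = word_e_max i xs" "word_eps i ys = k" by auto
  have "word_phi i ys > 0"
    using word_phi_word_e_max[of i xs] word_phi_word_e_max[of i ys] ys Suc.prems by simp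
  then obtain zs where "word_f i ys = Some zs" using word_f_eq_None_iff[of i ys] by fastforce
  then have "word_e i zs = Some ys" by (simp add: word_e_eq_Some_iff)
  then show ?case using ys word_e_max_Some word_eps_word_e by metis
qed

definition word_refl :: "node \<Rightarrow> letter list \<Rightarrow> letter list" where
  "word_refl i xs = (THE ys. word_e_max i ys = word_e_max i xs \<and> word_eps i ys = word_phi i xs)"

lemma word_refl:
  shows word_e_max_refl: "word_e_max i (word_refl i xs) = word_e_max i xs"
    and word_eps_refl: "word_eps i (word_refl i xs) = word_phi i xs"
    and word_phi_refl: "word_phi i (word_refl i xs) = word_eps i xs"
proof -
  have "\<exists>!ys. word_e_max i ys = word_e_max i xs \<and> word_eps i ys = word_phi i xs"
    using ex_word_in_string[of "word_phi i xs" i xs] word_e_max_inject[of i] by fastforce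
  from theI'[OF this] show 1: "word_e_max i (word_refl i xs) = word_e_max i xs"
    and 2: "word_eps i (word_refl i xs) = word_phi i xs"
    by (simp_all add: word_refl_def)
  show "word_phi i (word_refl i xs) = word_eps i xs"
    using word_phi_word_e_max[of i xs] word_phi_word_e_max[of i "word_refl i xs"] 1 2 by simp
qed

lemma word_refl_refl: "word_refl i (word_refl i xs) = xs"
  by (rule word_e_max_inject[of i])
    (simp_all add: word_e_max_refl word_eps_refl word_phi_refl)

lemma word_wt_refl: "word_wt (word_refl i xs) = simple_reflection i (word_wt xs)"
  using word_wt_word_e_max[of i xs] word_wt_word_e_max[of i "word_refl i xs"]
  by (simp add: word_e_max_refl word_eps_refl simple_reflection_def word_pairing wscale_def
      prod_eq_iff algebra_simps)

lemma crystal_word_refl: "word_refl i xs \<in> crystal la \<longleftrightarrow> xs \<in> crystal la"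
  using crystal_word_e_max[of i] by (metis word_e_max_refl)

lemma word_e_max_append:
  assumes "word_phi i p = 0"
  shows "word_e_max i (p @ q) = word_e_max i (p @ word_e_max i q)"
proof (induction q rule: word_e_max_induct[of i])
  case (None q)
  then show ?case by (simp add: word_e_max_None)
next
  case (Some q q')
  then have "word_e i (p @ q) = Some (p @ q')"
    by (simp add: word_e_append assms word_eps_word_e)
  with Some show ?case by (simp add: word_e_max_Some)
qed

text \<open>With phi = 0 on \<open>p\<close>, e_i works on the tail until that is exhausted. Hence
  both words have the same head of their i-string.\<close>

lemma crystal_append_refl:
  assumes "word_phi i p = 0"
  shows "p @ word_refl i q \<in> crystal la \<longleftrightarrow> p @ q \<in> crystal la"
  using crystal_word_e_max[of i] word_e_max_append[OF assms]
  by (metis word_e_max_refl)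

text \<open>The cancellation of Gessel and Zeilberger: cut a word after its shortest prefix that is not
  of highest weight and reflect the rest. That prefix has \<open>\<langle>wt, \<alpha>\<^sub>i\<^sup>\<or>\<rangle> = -1\<close> for the node \<open>i\<close>
  concerned, so that \<open>wt + \<rho>\<close> of the word is reflected too.\<close>

definition lift_pos :: "letter list \<Rightarrow> nat" where
  "lift_pos T = (LEAST k. \<exists>i. word_eps i (take k T) > 0)"

definition lift_node :: "letter list \<Rightarrow> node" where
  "lift_node T = (SOME i. word_eps i (take (lift_pos T) T) > 0)"

definition tail_refl :: "letter list \<Rightarrow> letter list" where
  "tail_refl T =
     take (lift_pos T) T @ word_refl (lift_node T) (drop (lift_pos T) T)"

text \<open>The prefix without its last letter has eps = 0. That letter has eps at most 1, and to
  remain uncancelled it needs phi = 0 before it.\<close>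

lemma lift_prefix:
  assumes "word_eps j T > 0"
  shows "word_eps (lift_node T) (take (lift_pos T) T) = 1"
    and "word_phi (lift_node T) (take (lift_pos T) T) = 0"
    and "lift_pos T \<le> length T"
proof -
  define k where "k = lift_pos T"
  define i where "i = lift_node T"
  have ex: "\<exists>k i. word_eps i (take k T) > 0" using assms by (metis take_all order_refl)
  have "\<exists>i. word_eps i (take k T) > 0"
    unfolding k_def lift_pos_def by (rule LeastI_ex) (rule ex)
  then have i: "word_eps i (take k T) > 0"
    unfolding k_def i_def lift_node_def by (rule someI_ex)
  have least: "word_eps l (take m T) = 0" if "m < k" for l m
    using not_less_Least[OF that[unfolded k_def lift_pos_def]] by auto
  show k: "lift_pos T \<le> length T"
    unfolding lift_pos_def by (rule Least_le) (use assms in auto)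
  have "k \<noteq> 0" using i by (cases k) auto
  then obtain m where m: "k = Suc m" by (cases k) auto
  with k have "m < length T" by (simp add: k_def)
  then have take: "take k T = take m T @ [T ! m]" by (simp add: m take_Suc_conv_app_nth)
  have letter: "word_eps i [x] = 0 \<or> (word_eps i [x] = 1 \<and> word_phi i [x] = 0)" for x
    by (cases i; cases x) (auto simp: letter_eps_phi)
  have "word_eps i (take m T) = 0" using least m by simp
  with i have "word_eps i [T ! m] = 1" "word_phi i (take m T) = 0" "word_phi i [T ! m] = 0"
    using letter[of "T ! m"] unfolding take word_eps_append by auto
  then show "word_eps (lift_node T) (take (lift_pos T) T) = 1"
    "word_phi (lift_node T) (take (lift_pos T) T) = 0"
    unfolding k_def[symmetric] i_def[symmetric] take word_eps_append word_phi_append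
    using least[of m i] m by auto
qed

text \<open>Cut and node depend only on the prefix, which is untouched, so a second application
  makes the same choices: \<open>tail_refl\<close> is an involution.\<close>

lemma tail_refl_prefix:
  assumes "word_eps j T > 0"
  shows "take (lift_pos T) (tail_refl T) = take (lift_pos T) T"
    and "drop (lift_pos T) (tail_refl T) = word_refl (lift_node T) (drop (lift_pos T) T)"
    and "word_eps (lift_node T) (tail_refl T) > 0"
    and "lift_pos (tail_refl T) = lift_pos T"
    and "lift_node (tail_refl T) = lift_node T"
proof -
  note T = lift_prefix[OF assms]
  show 1: "take (lift_pos T) (tail_refl T) = take (lift_pos T) T"
    and "drop (lift_pos T) (tail_refl T) = word_refl (lift_node T) (drop (lift_pos T) T)"
    using T(3) by (simp_all add: tail_refl_def)
  show "word_eps (lift_node T) (tail_refl T) > 0"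
    using T(1) by (simp add: tail_refl_def word_eps_append)
  have eq: "take k (tail_refl T) = take k T" if "k \<le> lift_pos T" for k
    using arg_cong[OF 1, of "take k"] that by (simp add: min_absorb1)
  have ex: "\<exists>i. word_eps i (take (lift_pos T) T) > 0" using T(1) by (metis zero_less_one)
  show 2: "lift_pos (tail_refl T) = lift_pos T"
    unfolding lift_pos_def[of "tail_refl T"]
  proof (rule Least_equality)
    show "\<exists>i. word_eps i (take (lift_pos T) (tail_refl T)) > 0" using ex by (simp add: 1)
  next
    fix k
    assume k: "\<exists>i. word_eps i (take k (tail_refl T)) > 0"
    show "lift_pos T \<le> k"
    proof (rule ccontr)
      assume "\<not> lift_pos T \<le> k"
      with k eq[of k] have "\<exists>i. word_eps i (take k T) > 0" by simp
      then have "lift_pos T \<le> k" unfolding lift_pos_def by (rule Least_le)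
      with \<open>\<not> lift_pos T \<le> k\<close> show False by simp
    qed
  qed
  show "lift_node (tail_refl T) = lift_node T" by (simp add: lift_node_def 2 1)
qed

lemma simple_reflection_add [simp]:
  "simple_reflection i (mu + nu) = simple_reflection i mu + simple_reflection i nu"
  by (cases i) (auto simp: simple_reflection_def wscale_def prod_eq_iff algebra_simps)

lemma simple_reflection_wall:
  "coroot_pairing i mu = 0 \<Longrightarrow> simple_reflection i mu = mu"
  by (simp add: simple_reflection_def wscale_def zero_prod_def[symmetric])

text \<open>The weight of the prefix plus \<rho> lies on the wall of the reflection and is fixed, so
  reflecting the tail reflects the whole.\<close>

lemma word_wt_tail_refl:
  assumes "word_eps j T > 0"
  shows "word_wt (tail_refl T) + rho = simple_reflection (lift_node T) (word_wt T + rho)"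
proof -
  let ?p = "take (lift_pos T) T" and ?q = "drop (lift_pos T) T" and ?i = "lift_node T"
  have "coroot_pairing ?i rho = 1" by (cases ?i) (auto simp: rho_def varpi1_def varpi2_def)
  then have "coroot_pairing ?i (word_wt ?p + rho) = 0"
    using lift_prefix(1,2)[OF assms] by (simp add: word_pairing)
  then have "simple_reflection ?i (word_wt ?p + rho) = word_wt ?p + rho"
    by (rule simple_reflection_wall)
  moreover have "word_wt T = word_wt ?p + word_wt ?q"
    by (metis append_take_drop_id word_wt_simps(3))
  ultimately show ?thesis
    by (simp add: tail_refl_def word_wt_refl algebra_simps)
qed

lemma sum_alternating_crystal:
  fixes F :: "weight \<Rightarrow> int"
  assumes "la \<in> X_plus" "\<And>i x. F (simple_reflection i x) = - F x"
  shows "(\<Sum>T\<in>crystal la. F (word_wt T + rho)) = F (la + rho)"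
proof -
  define A where "A = {T \<in> crystal la. \<exists>j. word_eps j T > 0}"
  have tail_refl: "tail_refl T \<in> A" "tail_refl (tail_refl T) = T"
    "F (word_wt (tail_refl T) + rho) = - F (word_wt T + rho)" if "T \<in> A" for T
  proof -
    from that obtain j where T: "T \<in> crystal la" and j: "word_eps j T > 0"
      by (auto simp: A_def)
    have "tail_refl T \<in> crystal la"
      using crystal_append_refl[OF lift_prefix(2)[OF j], of "drop (lift_pos T) T" la] T
      by (simp add: tail_refl_def)
    with tail_refl_prefix(3)[OF j] show "tail_refl T \<in> A" by (auto simp: A_def)
    show "tail_refl (tail_refl T) = T"
      by (simp add: tail_refl_def[of "tail_refl T"] tail_refl_prefix[OF j] word_refl_refl)
    show "F (word_wt (tail_refl T) + rho) = - F (word_wt T + rho)"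
      by (simp only: word_wt_tail_refl[OF j] assms(2))
  qed
  have "(\<Sum>T\<in>A. F (word_wt T + rho)) = (\<Sum>T\<in>A. F (word_wt (tail_refl T) + rho))"
    by (rule sum.reindex_bij_witness[of _ tail_refl tail_refl]) (simp_all add: tail_refl)
  also have "\<dots> = - (\<Sum>T\<in>A. F (word_wt T + rho))"
    by (simp add: tail_refl sum_negf)
  finally have zero: "(\<Sum>T\<in>A. F (word_wt T + rho)) = 0" by simp
  have "word_eps i (highest_word la) = 0" for i
    using assms(1)
    by (cases i) (auto simp: highest_word_kn kn_eps1 kn_eps2 kn_valid_def X_plus_def)
  then have diff: "crystal la - A = {highest_word la}"
    using crystal_highest_unique[OF assms(1)]
    by (auto simp: A_def crystal_highest) (metis neq0_conv)
  have "(\<Sum>T\<in>crystal la. F (word_wt T + rho)) =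
      (\<Sum>T\<in>crystal la - A. F (word_wt T + rho)) + (\<Sum>T\<in>A. F (word_wt T + rho))"
    by (rule sum.subset_diff) (auto simp: A_def finite_crystal)
  then show ?thesis by (simp add: zero diff word_wt_highest_word[OF assms(1)])
qed

lemma sum_crystal_weyl:
  fixes h :: "weight \<Rightarrow> int"
  assumes "w \<in> weyl_group"
  shows "(\<Sum>T\<in>crystal la. h (w (word_wt T))) = (\<Sum>T\<in>crystal la. h (word_wt T))"
  using assms
proof (induction arbitrary: h)
  case (weyl_step w i)
  have "(\<Sum>T\<in>crystal la. h (simple_reflection i (w (word_wt T)))) =
      (\<Sum>T\<in>crystal la. h (simple_reflection i (word_wt T)))"
    \<comment> \<open>The induction hypothesis is taken for \<open>h\<close> composed with the
      reflection.\<close>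
    by (rule weyl_step.IH)
  also have "\<dots> = (\<Sum>T\<in>crystal la. h (word_wt T))"
    by (rule sum.reindex_bij_witness[of _ "word_refl i" "word_refl i"])
      (simp_all add: word_refl_refl crystal_word_refl word_wt_refl)
  finally show ?case by simp
qed simp

section \<open>The Weyl group and Kostant's partition function\<close>

type_synonym matrix2 = "int \<times> int \<times> int \<times> int"

fun mat_apply :: "matrix2 \<Rightarrow> weight \<Rightarrow> weight" where
  "mat_apply (a, b, c, d) (x, y) = (a * x + b * y, c * x + d * y)"

fun mat_det :: "matrix2 \<Rightarrow> int" where
  "mat_det (a, b, c, d) = a * d - b * c"

text \<open>By rows, in the basis \<varpi>1, \<varpi>2: the elements 1, s1, s2, s1 s2, s2 s1, s2 s1
  s2, s1 s2 s1 and the longest one, -1.\<close>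

definition weyl_matrices :: "matrix2 set" where
  "weyl_matrices = {(1, 0, 0, 1), (-1, 0, 1, 1), (1, 2, 0, -1), (-1, -2, 1, 1),
     (1, 2, -1, -1), (1, 0, -1, -1), (-1, -2, 0, 1), (-1, 0, 0, -1)}"

lemma inj_mat_apply: "inj mat_apply"
proof
  fix m m'
  assume eq: "mat_apply m = mat_apply m'"
  show "m = m'"
    using fun_cong[OF eq, of "(1, 0)"] fun_cong[OF eq, of "(0, 1)"]
    by (cases m; cases m') auto
qed

lemma simple_reflection_simps [simp]:
  "simple_reflection Node1 (x, y) = (- x, x + y)"
  "simple_reflection Node2 (x, y) = (x + 2 * y, - y)"
  by (simp_all add: simple_reflection_def wscale_def)

lemma simple_reflection_comp_mat:
  "simple_reflection Node1 \<circ> mat_apply (a, b, c, d) = mat_apply (- a, - b, a + c, b + d)"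
  "simple_reflection Node2 \<circ> mat_apply (a, b, c, d) = mat_apply (a + 2 * c, b + 2 * d, - c, - d)"
  by (auto simp: fun_eq_iff algebra_simps)

lemma mat_apply_id: "mat_apply (1, 0, 0, 1) = id"
  by (auto simp: fun_eq_iff)

lemma weyl_group_eq: "weyl_group = mat_apply ` weyl_matrices"
proof
  show "weyl_group \<subseteq> mat_apply ` weyl_matrices"
  proof
    fix w
    assume "w \<in> weyl_group"
    then show "w \<in> mat_apply ` weyl_matrices"
    proof induction
      case weyl_id
      then show ?case by (metis mat_apply_id image_eqI insertI1 weyl_matrices_def)
    next
      case (weyl_step w i)
      then obtain m where "m \<in> weyl_matrices" "w = mat_apply m" by blast
      then show ?case
        by (cases i) (auto simp: weyl_matrices_def simple_reflection_comp_mat)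
    qed
  qed
  have id: "mat_apply (1, 0, 0, 1) \<in> weyl_group" by (simp add: mat_apply_id weyl_id)
  note step = weyl_step[of _ Node1] weyl_step[of _ Node2]
  have s1: "mat_apply (-1, 0, 1, 1) \<in> weyl_group"
    using step(1)[OF id] by (simp add: simple_reflection_comp_mat)
  have s2: "mat_apply (1, 2, 0, -1) \<in> weyl_group"
    using step(2)[OF id] by (simp add: simple_reflection_comp_mat)
  have s12: "mat_apply (-1, -2, 1, 1) \<in> weyl_group"
    using step(1)[OF s2] by (simp add: simple_reflection_comp_mat)
  have s21: "mat_apply (1, 2, -1, -1) \<in> weyl_group"
    using step(2)[OF s1] by (simp add: simple_reflection_comp_mat)
  have s212: "mat_apply (1, 0, -1, -1) \<in> weyl_group"
    using step(2)[OF s12] by (simp add: simple_reflection_comp_mat)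
  have s121: "mat_apply (-1, -2, 0, 1) \<in> weyl_group"
    using step(1)[OF s21] by (simp add: simple_reflection_comp_mat)
  have "mat_apply (-1, 0, 0, -1) \<in> weyl_group"
    using step(1)[OF s212] by (simp add: simple_reflection_comp_mat)
  with id s1 s2 s12 s21 s212 s121 show "mat_apply ` weyl_matrices \<subseteq> weyl_group"
    by (auto simp: weyl_matrices_def)
qed

lemma foldr_reflections_Cons:
  "foldr (\<lambda>i u. simple_reflection i \<circ> u) (i # is) id =
    simple_reflection i \<circ> foldr (\<lambda>i u. simple_reflection i \<circ> u) is id"
  by (simp only: foldr_Cons o_apply)

lemma foldr_reflections_mat:
  "\<exists>m. foldr (\<lambda>i u. simple_reflection i \<circ> u) is id = mat_apply m \<and> mat_det m = (-1) ^ length is"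
proof (induction "is")
  case Nil
  show ?case by (rule exI[of _ "(1, 0, 0, 1)"]) (simp add: mat_apply_id)
next
  case (Cons i "is")
  then obtain m where m: "foldr (\<lambda>i u. simple_reflection i \<circ> u) is id = mat_apply m"
    "mat_det m = (-1) ^ length is" by blast
  obtain a b c d where abcd: "m = (a, b, c, d)" by (metis prod_cases4)
  show ?case
  proof (cases i)
    case Node1
    show ?thesis
      unfolding foldr_reflections_Cons m(1) abcd Node1 simple_reflection_comp_mat
      by (rule exI[of _ "(- a, - b, a + c, b + d)"])
        (use m(2) in \<open>simp add: abcd algebra_simps\<close>)
  next
    case Node2
    show ?thesis
      unfolding foldr_reflections_Cons m(1) abcd Node2 simple_reflection_comp_mat
      by (rule exI[of _ "(a + 2 * c, b + 2 * d, - c, - d)"])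
        (use m(2) in \<open>simp add: abcd algebra_simps\<close>)
  qed
qed

text \<open>Every product of n simple reflections has determinant (-1)^n, in particular a shortest
  one; no length has to be computed.\<close>

lemma weyl_sign:
  assumes "mat_apply m \<in> weyl_group"
  shows "(-1) ^ weyl_length (mat_apply m) = mat_det m"
proof -
  let ?P = "\<lambda>w is. w = foldr (\<lambda>i u. simple_reflection i \<circ> u) is id"
  have "\<exists>is. ?P w is" if "w \<in> weyl_group" for w
    using that
  proof induction
    case weyl_id
    show ?case by (rule exI[of _ "[]"]) simp
  next
    case (weyl_step w i)
    then obtain "is" where "?P w is" by blast
    then show ?case by (intro exI[of _ "i # is"]) (simp only: foldr_reflections_Cons)
  qed
  with assms have "\<exists>n is. length is = n \<and> ?P (mat_apply m) is" by blast
  from LeastI_ex[OF this] obtain "is"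
    where "is": "length is = weyl_length (mat_apply m)" "?P (mat_apply m) is"
    unfolding weyl_length_def by blast
  from foldr_reflections_mat[of "is"] obtain m'
    where "mat_apply m = mat_apply m'" "mat_det m' = (-1) ^ length is"
    using "is"(2) by auto
  then show ?thesis using "is"(1) injD[OF inj_mat_apply] by metis
qed

lemma sum_weyl_group:
  fixes g :: "(weight \<Rightarrow> weight) \<Rightarrow> int"
  shows "(\<Sum>w\<in>weyl_group. (-1) ^ weyl_length w * g w) =
    (\<Sum>m\<in>weyl_matrices. mat_det m * g (mat_apply m))"
proof -
  have "(\<Sum>w\<in>weyl_group. (-1) ^ weyl_length w * g w) =
      (\<Sum>m\<in>weyl_matrices. (-1) ^ weyl_length (mat_apply m) * g (mat_apply m))"
    unfolding weyl_group_eq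
    by (rule sum.reindex[unfolded o_def]) (rule inj_on_subset[OF inj_mat_apply], simp)
  also have "\<dots> = (\<Sum>m\<in>weyl_matrices. mat_det m * g (mat_apply m))"
    by (rule sum.cong) (simp_all add: weyl_sign weyl_group_eq)
  finally show ?thesis .
qed

text \<open>The root set is a parameter so that roots can be removed one at a time.\<close>

definition vector_partitions :: "weight set \<Rightarrow> weight \<Rightarrow> (weight \<Rightarrow> nat) set" where
  "vector_partitions R nu =
     {m. (\<forall>b. b \<notin> R \<longrightarrow> m b = 0) \<and> (\<Sum>b\<in>R. wscale (int (m b)) b) = nu}"

lemma kostant_partitions_eq: "kostant_partitions nu = vector_partitions positive_roots nu"
  by (simp add: kostant_partitions_def vector_partitions_def)

lemma vector_partitions_outside: "m \<in> vector_partitions R nu \<Longrightarrow> b \<notin> R \<Longrightarrow> m b = 0"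
  unfolding vector_partitions_def by (drule CollectD, drule conjunct1, drule spec, drule mp)

lemma finite_vector_partitions:
  assumes "R \<subseteq> positive_roots"
  shows "finite (vector_partitions R nu)"
proof -
  \<comment> \<open>\<open>ht\<close> is positive on the positive roots, so it bounds the multiplicities.\<close>
  define ht :: "weight \<Rightarrow> int" where "ht = (\<lambda>mu. 2 * fst mu + 3 * snd mu)"
  have R: "finite R" using assms by (rule finite_subset) (simp add: positive_roots_def)
  have pos: "ht b \<ge> 1" if "b \<in> R" for b
    using that assms by (auto simp: positive_roots_def ht_def)
  have ht_sum: "ht (\<Sum>b\<in>R. wscale (int (m b)) b) = (\<Sum>b\<in>R. int (m b) * ht b)" for m
    using R by induction (auto simp: ht_def wscale_def algebra_simps)
  have "m b \<le> nat (ht nu)" if m: "m \<in> vector_partitions R nu" and b: "b \<in> R" for m b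
  proof -
    have "int (m b) \<le> int (m b) * ht b" using pos[OF b] by (simp add: mult_le_cancel_left1)
    also have "\<dots> \<le> (\<Sum>b\<in>R. int (m b) * ht b)"
    proof (rule member_le_sum[OF b _ R])
      show "0 \<le> int (m x) * ht x" if "x \<in> R - {b}" for x using pos[of x] that by auto
    qed
    also have "\<dots> = ht nu" using m ht_sum[of m] by (simp add: vector_partitions_def)
    finally show ?thesis by simp
  qed
  then have "vector_partitions R nu \<subseteq>
      {m. \<forall>b. (b \<in> R \<longrightarrow> m b \<in> {..nat (ht nu)}) \<and> (b \<notin> R \<longrightarrow> m b = 0)}"
    by (auto simp: vector_partitions_def)
  then show ?thesis
    by (rule finite_subset) (rule finite_set_of_finite_funs, simp_all add: R)
qed

definition partition_count :: "weight set \<Rightarrow> weight \<Rightarrow> int" where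
  "partition_count R nu = int (card (vector_partitions R nu))"

lemma partition_count_empty: "partition_count {} nu = of_bool (nu = 0)"
proof -
  have "vector_partitions {} nu = (if nu = 0 then {\<lambda>_. 0} else {})"
    by (auto simp: vector_partitions_def)
  then show ?thesis by (simp add: partition_count_def)
qed

text \<open>Either \<open>b\<close> does not occur, or one copy of it is removed. In generating
  functions, multiplying by 1 - e^b deletes the factor of \<open>b\<close>.\<close>

lemma partition_count_insert:
  assumes "insert b R \<subseteq> positive_roots" "b \<notin> R"
  shows "partition_count (insert b R) nu =
    partition_count R nu + partition_count (insert b R) (nu - b)"
proof -
  have R: "finite R"
    using assms(1) by (rule finite_subset[OF subset_trans[OF subset_insertI]])
      (simp add: positive_roots_def)
  define inc where "inc = (\<lambda>m :: weight \<Rightarrow> nat. m(b := Suc (m b)))"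
  have rest: "(\<Sum>x\<in>R. wscale (int ((m(b := k)) x)) x) = (\<Sum>x\<in>R. wscale (int (m x)) x)" for m k
    by (rule sum.cong) (use assms(2) in auto)
  have scale: "wscale (int (Suc k)) b = b + wscale (int k) b" "wscale 0 b = 0" for k
    by (auto simp: wscale_def prod_eq_iff algebra_simps)
  have zero: "{m \<in> vector_partitions (insert b R) nu. m b = 0} = vector_partitions R nu"
  proof (rule set_eqI)
    fix m
    show "m \<in> {m \<in> vector_partitions (insert b R) nu. m b = 0} \<longleftrightarrow> m \<in> vector_partitions R nu"
    proof (cases "m b = 0")
      case True
      then have "(\<forall>x. x \<notin> insert b R \<longrightarrow> m x = 0) \<longleftrightarrow> (\<forall>x. x \<notin> R \<longrightarrow> m x = 0)"
        by (metis insert_iff)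
      with True assms(2) R show ?thesis by (simp add: vector_partitions_def scale)
    next
      case False
      then have "m \<notin> vector_partitions R nu" 
        using vector_partitions_outside[of m R nu, OF _ assms(2)] by auto
      with False show ?thesis by simp
    qed
  qed
  have suc: "{m \<in> vector_partitions (insert b R) nu. m b \<noteq> 0} =
      inc ` vector_partitions (insert b R) (nu - b)"
  proof (intro subset_antisym subsetI)
    fix m
    assume m: "m \<in> {m \<in> vector_partitions (insert b R) nu. m b \<noteq> 0}"
    then obtain k where k: "m b = Suc k" by (auto simp: gr0_conv_Suc)
    have "m = inc (m(b := k))" by (auto simp: inc_def k)
    moreover have "m(b := k) \<in> vector_partitions (insert b R) (nu - b)"
      using m assms(2) R by (auto simp: vector_partitions_def rest k scale algebra_simps
          simp del: of_nat_Suc fun_upd_apply) (auto simp: scale algebra_simps)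
    ultimately show "m \<in> inc ` vector_partitions (insert b R) (nu - b)" by blast
  next
    fix m
    assume "m \<in> inc ` vector_partitions (insert b R) (nu - b)"
    then obtain l where l: "m = inc l" "l \<in> vector_partitions (insert b R) (nu - b)" by blast
    have "(\<Sum>x\<in>insert b R. wscale (int (m x)) x) = b + (\<Sum>x\<in>insert b R. wscale (int (l x)) x)"
      using R assms(2) by (simp add: l(1) inc_def rest scale add_ac del: of_nat_Suc fun_upd_apply)
        (simp add: scale add_ac del: of_nat_Suc)
    then show "m \<in> {m \<in> vector_partitions (insert b R) nu. m b \<noteq> 0}"
      using l by (auto simp: vector_partitions_def inc_def)
  qed
  have "inj inc"
  proof
    fix l m
    assume "inc l = inc m"
    then have "inc l x = inc m x" for x by simp
    then have "l x = m x" for x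
      unfolding inc_def by (metis fun_upd_other fun_upd_same nat.inject)
    then show "l = m" by blast
  qed
  have "vector_partitions (insert b R) nu =
      {m \<in> vector_partitions (insert b R) nu. m b = 0} \<union>
      {m \<in> vector_partitions (insert b R) nu. m b \<noteq> 0}" by blast
  then have "card (vector_partitions (insert b R) nu) =
      card {m \<in> vector_partitions (insert b R) nu. m b = 0} +
      card {m \<in> vector_partitions (insert b R) nu. m b \<noteq> 0}"
    using finite_vector_partitions[OF assms(1), of nu] by (subst card_Un_disjoint[symmetric]) auto
  also have "\<dots> = card (vector_partitions R nu) +
      card (vector_partitions (insert b R) (nu - b))"
    unfolding zero suc
    by (subst card_image) (auto intro: inj_on_subset[OF \<open>inj inc\<close>])
  finally show ?thesis by (simp add: partition_count_def)
qed

abbreviation kostant :: "weight \<Rightarrow> int" where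
  "kostant \<equiv> partition_count positive_roots"

text \<open>Weyl's denominator formula \<open>\<Sum>w. (-1)\<^bsup>\<ell>(w)\<^esup> e\<^bsup>w \<rho> - \<rho>\<^esup> = \<Prod>\<beta>. (1 - e\<^bsup>-\<beta>\<^esup>)\<close>, where each factor
  removes one root from the partition function.\<close>

lemma alternating_kostant:
  "(\<Sum>m\<in>weyl_matrices. mat_det m * kostant (nu + mat_apply m rho - rho)) = of_bool (nu = 0)"
proof -
  obtain x y where nu: "nu = (x, y)" by (cases nu)
  define P3 where "P3 = partition_count {(-2, 2), (2, 0), (0, 1)}"
  define P2 where "P2 = partition_count {(2, 0), (0, 1)}"
  define P1 where "P1 = partition_count {(0, 1)}"
  have P3: "P3 mu = kostant mu - kostant (mu - (2, -1))" for mu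
    using partition_count_insert[of "(2, -1)" "{(-2, 2), (2, 0), (0, 1)}" mu]
    by (simp add: P3_def positive_roots_def)
  have P2: "P2 mu = P3 mu - P3 (mu - (-2, 2))" for mu
    using partition_count_insert[of "(-2, 2)" "{(2, 0), (0, 1)}" mu]
    by (simp add: P2_def P3_def positive_roots_def)
  have P1: "P1 mu = P2 mu - P2 (mu - (2, 0))" for mu
    using partition_count_insert[of "(2, 0)" "{(0, 1)}" mu]
    by (simp add: P1_def P2_def positive_roots_def)
  have "of_bool (nu = 0) = P1 nu - P1 (nu - (0, 1))"
    using partition_count_insert[of "(0, 1)" "{}" nu]
    by (simp add: P1_def positive_roots_def partition_count_empty)
  \<comment> \<open>The expansion has 16 terms, one for each subset of the positive roots. Eight of
    them cancel in pairs, as \<alpha>1 + \<alpha>2 = \<alpha>21 and \<alpha>1 + \<alpha>21 =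
    \<alpha>12; the others are the terms of the Weyl group.\<close>
  then show ?thesis
    by (simp add: P1 P2 P3 nu weyl_matrices_def rho_def varpi1_def varpi2_def algebra_simps)
qed

section \<open>Kostant's multiplicity formula for the crystal\<close>

lemma mat_apply_add: "mat_apply m (mu + nu) = mat_apply m mu + mat_apply m nu"
  by (cases m; cases mu; cases nu) (auto simp: algebra_simps)

theorem card_crystal_weight:
  assumes "la \<in> X_plus"
  shows "int (card {T \<in> crystal la. word_wt T = mu}) =
    (\<Sum>m\<in>weyl_matrices. mat_det m * kostant (mat_apply m (la + rho) - (mu + rho)))"
proof -
  define F where
    "F = (\<lambda>x. \<Sum>m\<in>weyl_matrices. mat_det m * kostant (mat_apply m x - (mu + rho)))"
  \<comment> \<open>Composition with a simple reflection permutes the eight matrices and changes the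
    sign of each determinant.\<close>
  have alternating: "F (simple_reflection i x) = - F x" for i x
    by (cases x; cases i) (simp_all add: F_def weyl_matrices_def algebra_simps)
  have "F (la + rho) = (\<Sum>T\<in>crystal la. F (word_wt T + rho))"
    using sum_alternating_crystal[OF assms, of F] alternating by simp
  also have "\<dots> = (\<Sum>m\<in>weyl_matrices. \<Sum>T\<in>crystal la.
      mat_det m * kostant (mat_apply m (word_wt T) + mat_apply m rho - (mu + rho)))"
    unfolding F_def mat_apply_add by (rule sum.swap)
  \<comment> \<open>Invariance is applied for each matrix separately and only to the weight of
    \<open>T\<close>; the image of \<rho> stays and produces the denominator sum.\<close>
  also have "\<dots> = (\<Sum>m\<in>weyl_matrices. \<Sum>T\<in>crystal la.
      mat_det m * kostant (word_wt T + mat_apply m rho - (mu + rho)))"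
  proof (rule sum.cong[OF refl])
    fix m
    assume "m \<in> weyl_matrices"
    then have "mat_apply m \<in> weyl_group" by (simp add: weyl_group_eq)
    from sum_crystal_weyl[OF this,
        where h = "\<lambda>x. mat_det m * kostant (x + mat_apply m rho - (mu + rho))"]
    show "(\<Sum>T\<in>crystal la.
          mat_det m * kostant (mat_apply m (word_wt T) + mat_apply m rho - (mu + rho))) =
        (\<Sum>T\<in>crystal la. mat_det m * kostant (word_wt T + mat_apply m rho - (mu + rho)))" .
  qed
  also have "\<dots> = (\<Sum>T\<in>crystal la. \<Sum>m\<in>weyl_matrices.
      mat_det m * kostant ((word_wt T - mu) + mat_apply m rho - rho))"
    by (subst sum.swap) (simp add: algebra_simps)
  also have "\<dots> = (\<Sum>T\<in>crystal la. of_bool (word_wt T = mu))"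
    by (simp add: alternating_kostant)
  also have "\<dots> = int (card {T \<in> crystal la. word_wt T = mu})"
    by (simp add: finite_crystal Int_def)
  finally show ?thesis by (simp add: F_def)
qed

section \<open>Specialization at \<open>v = 1\<close>\<close>

text \<open>Sums over a common finite set of exponents make additivity provable even where terms
  cancel and \<open>keys\<close> shrinks.\<close>

lemma laurent_at_1_superset:
  assumes "finite A" "Poly_Mapping.keys p \<subseteq> A"
  shows "laurent_at_1 p = (\<Sum>k\<in>A. Poly_Mapping.lookup p k)"
  unfolding laurent_at_1_def
  by (rule sum.mono_neutral_left) (use assms in \<open>auto simp: in_keys_iff\<close>)

lemma laurent_at_1_add [simp]: "laurent_at_1 (p + q) = laurent_at_1 p + laurent_at_1 q"
proof -
  let ?A = "Poly_Mapping.keys p \<union> Poly_Mapping.keys q"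
  have "laurent_at_1 (p + q) = (\<Sum>k\<in>?A. Poly_Mapping.lookup (p + q) k)"
    by (rule laurent_at_1_superset) (simp_all add: Poly_Mapping.keys_add)
  also have "\<dots> = laurent_at_1 p + laurent_at_1 q"
    by (simp add: lookup_add sum.distrib laurent_at_1_superset[of ?A])
  finally show ?thesis .
qed

lemma laurent_at_1_single [simp]: "laurent_at_1 (Poly_Mapping.single k c) = c"
  by (subst laurent_at_1_superset[of "{k}"]) auto

lemma laurent_at_1_0 [simp]: "laurent_at_1 0 = 0"
  by (simp add: laurent_at_1_def)

lemma laurent_at_1_diff [simp]: "laurent_at_1 (p - q) = laurent_at_1 p - laurent_at_1 q"
  using laurent_at_1_add[of "p - q" q] by simp

lemma laurent_at_1_sum: "laurent_at_1 (sum f A) = (\<Sum>a\<in>A. laurent_at_1 (f a))"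
  by (induction A rule: infinite_finite_induct) auto

text \<open>Monomial factors suffice: \<open>poly_at_v2\<close> unfolds by Horner's scheme into
  multiplications by v^2, and v^2 is also the factor in \<open>N3_tilde\<close>.\<close>

lemma laurent_at_1_single_mult:
  "laurent_at_1 (Poly_Mapping.single k c * p) = c * laurent_at_1 p"
proof (induction p rule: update_induct)
  case const
  then show ?case by simp
next
  case (update p l d)
  have "Poly_Mapping.update l d p = p + Poly_Mapping.single l d"
    using update(1)
    by (intro poly_mapping_eqI) (auto simp: lookup_update lookup_add lookup_single when_def in_keys_iff)
  with update(3) show ?case by (simp add: distrib_left mult_single)
qed

lemma v_power: "v ^ n = Poly_Mapping.single (int n) 1"
  by (induction n) (auto simp: v_def mult_single)

lemma laurent_at_1_poly_at_v2: "laurent_at_1 (poly_at_v2 p) = poly p 1"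
proof (induction p)
  case 0
  then show ?case by (simp add: poly_at_v2_def)
next
  case (pCons a p)
  have of_int: "(of_int a :: laurent) = Poly_Mapping.single 0 a"
    by (subst single_of_int[symmetric]) simp
  from pCons show ?case
    by (simp add: poly_at_v2_def map_poly_pCons of_int v_power laurent_at_1_single_mult)
qed

lemma lookup_specialize_v1:
  "Poly_Mapping.lookup (specialize_v1 h) mu = laurent_at_1 (Poly_Mapping.lookup h mu)"
proof -
  have "Poly_Mapping.lookup (specialize_v1 h) mu =
      (\<Sum>x\<in>Poly_Mapping.keys h. if x = mu then laurent_at_1 (Poly_Mapping.lookup h mu) else 0)"
    unfolding specialize_v1_def lookup_sum
    by (rule sum.cong) (auto simp: lookup_single when_def)
  then show ?thesis by (simp add: in_keys_iff)
qed

lemma lookup_hscale: "Poly_Mapping.lookup (hscale c h) mu = c * Poly_Mapping.lookup h mu"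
  by (auto simp: hscale_def Poly_Mapping.map.rep_eq when_def)

lemma poly_q_kostant: "poly (q_kostant nu) 1 = kostant nu"
  by (simp add: q_kostant_def kostant_partitions_eq partition_count_def poly_sum poly_monom)

lemma poly_kostka_foulkes:
  "poly (kostka_foulkes la mu) 1 =
    (\<Sum>m\<in>weyl_matrices. mat_det m * kostant (mat_apply m (la + rho) - (mu + rho)))"
  using sum_weyl_group[of "\<lambda>w. kostant (w (la + rho) - (mu + rho))"]
  by (simp add: kostka_foulkes_def poly_sum poly_q_kostant)

text \<open>Needed because a sum over an infinite set is 0 by convention. For \<open>la - mu\<close>
  the combinations fst + snd and fst + 2 snd are \<open>a\<close> and \<open>2 * b\<close>, hence
  nonnegative.\<close>

lemma finite_dominance_le: "finite {mu \<in> X_plus. dominance_le mu la}"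
proof -
  have "fst mu \<le> fst la + snd la \<and> snd mu \<le> fst la + 2 * snd la"
    if mu: "mu \<in> X_plus" "dominance_le mu la" for mu
  proof -
    from mu(2) obtain a b :: nat where
      "la - mu = wscale (int a) (simple_root Node1) + wscale (int b) (simple_root Node2)"
      unfolding dominance_le_def by blast
    then have "fst la - fst mu = 2 * int a - 2 * int b" "snd la - snd mu = - int a + 2 * int b"
      by (auto simp: wscale_def prod_eq_iff)
    with mu(1) show ?thesis by (auto simp: X_plus_def)
  qed
  then have "{mu \<in> X_plus. dominance_le mu la} \<subseteq> {0..fst la + snd la} \<times> {0..fst la + 2 * snd la}"
    by (auto simp: X_plus_def)
  then show ?thesis by (rule finite_subset) simp
qed

lemma lookup_specialize_H_KL:
  assumes "la \<in> X_plus"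
  shows "Poly_Mapping.lookup (specialize_v1 (H_KL la)) mu =
    (if mu \<in> X_plus then int (card {T \<in> crystal la. word_wt T = mu}) else 0)"
proof -
  let ?D = "{mu \<in> X_plus. dominance_le mu la}"
  have "Poly_Mapping.lookup (specialize_v1 (H_KL la)) mu =
      (\<Sum>x\<in>?D. laurent_at_1 (poly_at_v2 (kostka_foulkes la x) * Poly_Mapping.lookup (H_std x) mu))"
    using assms
    by (simp add: H_KL_def H_KL_dominant_def lookup_specialize_v1 lookup_sum lookup_hscale
        laurent_at_1_sum)
  also have "\<dots> = (\<Sum>x\<in>?D. if x = mu then poly (kostka_foulkes la mu) 1 else 0)"
    by (rule sum.cong) (auto simp: H_std_def lookup_single when_def laurent_at_1_poly_at_v2)
  also have "\<dots> = (if mu \<in> ?D then poly (kostka_foulkes la mu) 1 else 0)"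
    using finite_dominance_le[of la] by simp
  also have "poly (kostka_foulkes la mu) 1 = int (card {T \<in> crystal la. word_wt T = mu})"
    by (simp add: poly_kostka_foulkes card_crystal_weight[OF assms])
  finally have eq: "Poly_Mapping.lookup (specialize_v1 (H_KL la)) mu =
    (if mu \<in> ?D then int (card {T \<in> crystal la. word_wt T = mu}) else 0)" .
  show ?thesis
  proof (cases "dominance_le mu la")
    case True
    then show ?thesis using eq by simp
  next
    case False
    \<comment> \<open>\<open>H_KL\<close> is truncated to weights below \<open>la\<close>, so its
      coefficient is 0 here and the crystal must have no such weight.\<close>
    then have "{T \<in> crystal la. word_wt T = mu} = {}"
      using dominance_le_crystal[OF assms] by blast
    then have "card {T \<in> crystal la. word_wt T = mu} = 0" by (simp only: card.empty)
    with False eq show ?thesis by simp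
  qed
qed

lemma lookup_ungraded_character:
  assumes "finite C"
  shows "Poly_Mapping.lookup (ungraded_character C) mu =
    (if mu \<in> X_plus then int (card {T \<in> C. word_wt T = mu}) else 0)"
proof -
  have "Poly_Mapping.lookup (ungraded_character C) mu =
      (\<Sum>T\<in>{T \<in> C. word_wt T \<in> X_plus}. of_bool (word_wt T = mu))"
    unfolding ungraded_character_def lookup_sum
    by (rule sum.cong) (auto simp: lookup_single when_def)
  also have "\<dots> = int (card {T \<in> C. word_wt T \<in> X_plus \<and> word_wt T = mu})"
    using assms by (simp add: Int_def conj_assoc)
  also have "{T \<in> C. word_wt T \<in> X_plus \<and> word_wt T = mu} =
      (if mu \<in> X_plus then {T \<in> C. word_wt T = mu} else {})"
    by auto
  finally show ?thesis by simp
qed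

lemma ungraded_character_crystal:
  assumes "la \<in> X_plus"
  shows "ungraded_character (crystal la) = specialize_v1 (H_KL la)"
  by (rule poly_mapping_eqI)
    (simp add: lookup_ungraded_character finite_crystal lookup_specialize_H_KL[OF assms])

lemma specialize_v1_diff_v2:
  "specialize_v1 (h - hscale (v ^ 2) g) = specialize_v1 h - specialize_v1 g"
  by (rule poly_mapping_eqI)
    (simp add: lookup_specialize_v1 lookup_minus lookup_hscale v_power laurent_at_1_single_mult)

lemma specialize_v1_0: "specialize_v1 0 = 0"
  by (simp add: specialize_v1_def)

text \<open>\<open>la + rho\<close> has first coordinate 0 and is fixed by s1. This is the case
  \<open>fst la = 1\<close> of \<open>N3_tilde\<close>, where the preatom is the whole
  crystal.\<close>

lemma H_KL_wall:
  assumes "fst la = -1"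
  shows "H_KL la = 0"
proof -
  have "simple_reflection Node1 \<in> weyl_group" using weyl_step[OF weyl_id, of Node1] by simp
  moreover have "simple_reflection Node1 (1, 0) \<noteq> id (1, 0)" by simp
  then have "simple_reflection Node1 \<noteq> id" by metis
  moreover have "simple_reflection Node1 (la + rho) = la + rho"
    using assms by (simp add: simple_reflection_wall rho_def varpi1_def varpi2_def del: simple_reflection_add)
  ultimately have "\<exists>w\<in>weyl_group. w \<noteq> id \<and> w (la + rho) = la + rho" by blast
  then show ?thesis using assms by (simp add: H_KL_def X_plus_def)
qed

lemma ungraded_character_preatom:
  assumes "la \<in> X_plus" "2 \<le> fst la"
  shows "ungraded_character (preatom la) =
    ungraded_character (crystal la) - ungraded_character (crystal (la - wscale 2 varpi1))"
proof (rule poly_mapping_eqI)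
  fix mu
  let ?la' = "la - wscale 2 varpi1"
  have la': "?la' \<in> X_plus" using assms by (auto simp: X_plus_def varpi1_def wscale_def)
  let ?A = "{T \<in> crystal la. word_wt T = mu}" and ?B = "{T \<in> crystal ?la'. word_wt T = mu}"
  have eq: "{T \<in> preatom la. word_wt T = mu} = ?A - Phi ?la' ` ?B"
    using assms(2) word_wt_Phi[OF la'] by (auto simp: preatom_def)
  have sub: "Phi ?la' ` ?B \<subseteq> ?A"
    using Phi_in_crystal[OF la'] word_wt_Phi[OF la'] by auto
  have card: "card (Phi ?la' ` ?B) = card ?B"
    by (rule card_image) (auto intro: inj_on_subset[OF inj_on_Phi[OF la']])
  have fin: "finite ?A" by (simp add: finite_crystal)
  have "card (?A - Phi ?la' ` ?B) = card ?A - card ?B"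
    using card_Diff_subset[OF finite_subset[OF sub fin] sub] by (simp only: card)
  \<comment> \<open>This turns the truncated difference of natural numbers into a difference of
    integers.\<close>
  moreover have "card ?B \<le> card ?A" using card_mono[OF fin sub] by (simp only: card)
  ultimately have "int (card {T \<in> preatom la. word_wt T = mu}) = int (card ?A) - int (card ?B)"
    unfolding eq by simp
  moreover have "finite (preatom la)" by (simp add: preatom_def finite_crystal)
  ultimately show "Poly_Mapping.lookup (ungraded_character (preatom la)) mu =
      Poly_Mapping.lookup
        (ungraded_character (crystal la) - ungraded_character (crystal ?la')) mu"
    by (simp add: lookup_ungraded_character finite_crystal lookup_minus)
qed

theorem proposition3p12:
  fixes la :: weight
  assumes "la \<in> X_plus"
  shows "ungraded_character (crystal la) = specialize_v1 (H_KL la) \<and>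
         ungraded_character (preatom la) = specialize_v1 (N3_tilde la)"
proof
  show 1: "ungraded_character (crystal la) = specialize_v1 (H_KL la)"
    by (rule ungraded_character_crystal[OF assms])
  let ?la' = "la - wscale 2 varpi1"
  have fst: "fst ?la' = fst la - 2" by (simp add: wscale_def varpi1_def)
  consider "fst la = 0" | "fst la = 1" | "2 \<le> fst la" using assms by (force simp: X_plus_def)
  then show "ungraded_character (preatom la) = specialize_v1 (N3_tilde la)"
  proof cases
    case 1
    then show ?thesis
      using ungraded_character_crystal[OF assms] by (simp add: preatom_def N3_tilde_def)
  next
    case 2
    then have "H_KL ?la' = 0" using fst by (intro H_KL_wall) simp
    with 2 show ?thesis
      using ungraded_character_crystal[OF assms]
      by (simp add: preatom_def N3_tilde_def specialize_v1_diff_v2 specialize_v1_0)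
  next
    case 3
    then have "?la' \<in> X_plus" using assms by (auto simp: X_plus_def wscale_def varpi1_def)
    with 3 show ?thesis
      by (simp add: ungraded_character_preatom assms N3_tilde_def specialize_v1_diff_v2
          ungraded_character_crystal)
  qed
qed


end
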